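(* For each plane near-cubic graph $\tilde{G}=(G,v,\nu)$ with $d(\tilde{G})\ge 2$, the vector $n_{\tilde{G}}=(n_{\tilde{G}}(\psi))_{\psi\in\mathcal{P}_{d(\tilde{G})}}$ belongs to the coloring count cone $B_{d(\tilde{G})}$.
   Context: Near-cubic graphs. Graphs are finite and may have loops and parallel edges. Each edge $e=uw$ consists of two half-edges $(e,u)$ and $(e,w)$ (two different half-edges even if $e$ is a loop); $(e,u)$ is incident with $u$, and the degree of a vertex is the number of half-edges incident with it. A near-cubic graph is a triple $\tilde{G}=(G,v,\nu)$, where $G$ is a connected graph, $v$ is a vertex of $G$, all vertices of $G$ other than $v$ have degree three, and $\nu$ is a bijection from the half-edges incident with $v$ to $\{0,\ldots,\deg(v)-1\}$. Let $d(\tilde{G})=\deg(v)$. It is a plane near-cubic graph if $G$ is a plane graph and the half-edges incident with $v$ are drawn around $v$ in the clockwise cyclic order $\nu^{-1}(0),\ldots,\nu^{-1}(\deg(v)-1)$. Colorings. A $3$-edge-coloring of $\tilde{G}$ assigns colors $1,2,3$ to the edges of $G$ so that at each vertex $u\neq v$ the three half-edges incident with $u$ belong to edges of three different colors (so there is none if some vertex other than $v$ has a loop); there is no constraint at $v$. For $d\ge 2$, a $d$-precoloring is a function $\psi:\{0,\ldots,d-1\}\to\{1,2,3\}$ with $|\psi^{-1}(1)|\equiv|\psi^{-1}(2)|\equiv|\psi^{-1}(3)|\equiv d\pmod 2$. $\mathcal{P}_d$ is the set of all $d$-precolorings. A $3$-edge-coloring $\varphi$ extends a $d(\tilde{G})$-precoloring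 $\psi$ if $\varphi(e)=\psi(\nu(h))$ for every edge $e$ incident with $v$ and every half-edge $h$ of $e$ incident with $v$. $n_{\tilde{G}}(\psi)$ is the number of $3$-edge-colorings of $\tilde{G}$ extending $\psi$; thus $n_{\tilde{G}}\in\mathbb{R}^{\mathcal{P}_{d(\tilde{G})}}$. Coloring count cones. For $d\ge 2$, a $d$-signature is a set $S$ of pairs $(m,s)$, where $m$ is an unordered pair of distinct integers in $\{0,\ldots,d-1\}$ and $s\in\{-1,1\}$, such that (i) $m_1\cap m_2=\emptyset$ for any distinct $(m_1,s_1),(m_2,s_2)\in S$, and (ii) $S$ does not contain elements $(\{a,b\},s_1)$ and $(\{c,e\},s_2)$ with $a<c<b<e$. $\mathcal{S}_d$ is the set of all $d$-signatures. A $d$-precoloring $\psi$ is compatible in distinct colors $i,j\in\{1,2,3\}$ with $S$ if $\psi^{-1}(\{i,j\})=\bigcup_{(m,s)\in S}m$ and, for each $(\{a_1,a_2\},s)\in S$, $\psi(a_1)=\psi(a_2)$ holds if and only if $s=-1$. $\mathcal{S}_{\psi,ij}$ is the set of $d$-signatures compatible with $\psi$ in colors $i,j$. The coloring count cone $B_d$ is the set of all $x\in\mathbb{R}^{\mathcal{P}_d}$ such that $x(\psi)\ge 0$ for every $d$-precoloring $\psi$ and there exists $y\in\mathbb{R}^{\mathcal{S}_d}$ with $y(S)\ge 0$ for every $d$-signature $S$ and $x(\psi)=\sum_{S\in\mathcal{S}_{\psi,ij}}y(S)$ for every $d$-precoloring $\psi$ and all distinct $i,j\in\{1,2,3\}$.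 *)

theory Defs
  imports "Graph_Theory.Digraph_Component" "HOL-Analysis.Analysis"
begin

text \<open>
  An undirected multigraph (loops and parallel edges allowed) is represented by a digraph
  whose arcs are the edges, each with an arbitrary reference orientation that carries no meaning.
  The two half-edges of \<open>e\<close> are \<open>(e, False)\<close>, at the tail, and \<open>(e, True)\<close>, at the head; so
  a loop also has two different half-edges.
\<close>

definition half_edge_end :: "('a, 'b) pre_digraph \<Rightarrow> 'b \<times> bool \<Rightarrow> 'a" where
  "half_edge_end G h = (if snd h then head G (fst h) else tail G (fst h))"

definition half_edges_at :: "('a, 'b) pre_digraph \<Rightarrow> 'a \<Rightarrow> ('b \<times> bool) set" where
  "half_edges_at G u = {h \<in> arcs G \<times> UNIV. half_edge_end G h = u}"

definition vertex_degree :: "('a, 'b) pre_digraph \<Rightarrow> 'a \<Rightarrow> nat" where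
  "vertex_degree G u = card (half_edges_at G u)"

text \<open>
  \<open>Digraph_Component.connected\<close> refers to the underlying undirected graph; the qualifier
  distinguishes it from topological connectedness.
\<close>

definition near_cubic_graph ::
    "('a, 'b) pre_digraph \<Rightarrow> 'a \<Rightarrow> ('b \<times> bool \<Rightarrow> nat) \<Rightarrow> bool" where
  "near_cubic_graph G v \<nu> \<longleftrightarrow>
     fin_digraph G \<and> Digraph_Component.connected G \<and> v \<in> verts G \<and>
     (\<forall>u \<in> verts G - {v}. vertex_degree G u = 3) \<and>
     bij_betw \<nu> (half_edges_at G v) {0..<vertex_degree G v}"

text \<open>
  A drawing places the vertices at points \<open>pos u\<close> of the plane and draws each edge \<open>e\<close> as a
  (not necessarily polygonal) curve \<open>curve e\<close>. Here \<^const>\<open>simple_path\<close> admits simple closed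
  curves, which occur exactly for the loops.
\<close>

definition plane_drawing ::
    "('a, 'b) pre_digraph \<Rightarrow> ('a \<Rightarrow> complex) \<Rightarrow> ('b \<Rightarrow> real \<Rightarrow> complex) \<Rightarrow> bool" where
  "plane_drawing G pos curve \<longleftrightarrow>
     inj_on pos (verts G) \<and>
     (\<forall>e \<in> arcs G. simple_path (curve e) \<and>
        pathstart (curve e) = pos (tail G e) \<and> pathfinish (curve e) = pos (head G e) \<and>
        curve e ` {0<..<1} \<inter> pos ` verts G = {}) \<and>
     (\<forall>e \<in> arcs G. \<forall>f \<in> arcs G. e \<noteq> f \<longrightarrow> curve e ` {0<..<1} \<inter> curve f ` {0<..<1} = {})"

definition half_edge_curve :: "('b \<Rightarrow> real \<Rightarrow> complex) \<Rightarrow> 'b \<times> bool \<Rightarrow> real \<Rightarrow> complex" where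
  "half_edge_curve curve h = (if snd h then reversepath (curve (fst h)) else curve (fst h))"

definition first_hit :: "(real \<Rightarrow> complex) \<Rightarrow> real \<Rightarrow> complex \<Rightarrow> bool" where
  "first_hit g r z \<longleftrightarrow>
     (\<exists>t \<in> {0..1}. g t = z \<and> dist (pathstart g) z = r \<and>
        (\<forall>s \<in> {0..<t}. dist (pathstart g) (g s) < r))"

text \<open>
  The curves need not have tangents at \<open>v\<close>, so the cyclic order around \<open>v\<close> is read off from the
  points where the half-edges first reach a circle around \<open>v\<close> (which all of them must do).
  The initial pieces of the half-edges up to these points form a star inside the disc, and the
  resulting cyclic order is the same for every such radius. Clockwise means that the angles
  decrease, within a single turn.
\<close>

definition drawn_clockwise ::
    "('a, 'b) pre_digraph \<Rightarrow> 'a \<Rightarrow> ('b \<times> bool \<Rightarrow> nat) \<Rightarrow>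
     ('a \<Rightarrow> complex) \<Rightarrow> ('b \<Rightarrow> real \<Rightarrow> complex) \<Rightarrow> bool" where
  "drawn_clockwise G v \<nu> pos curve \<longleftrightarrow>
     (\<exists>r > 0. \<exists>\<theta> :: nat \<Rightarrow> real.
        (\<forall>h \<in> half_edges_at G v.
           first_hit (half_edge_curve curve h) r (pos v + of_real r * cis (\<theta> (\<nu> h)))) \<and>
        (\<forall>k < vertex_degree G v. \<forall>j < k. \<theta> k < \<theta> j) \<and>
        (\<forall>k < vertex_degree G v. \<theta> 0 - 2 * pi < \<theta> k))"

definition plane_near_cubic_graph ::
    "('a, 'b) pre_digraph \<Rightarrow> 'a \<Rightarrow> ('b \<times> bool \<Rightarrow> nat) \<Rightarrow>
     ('a \<Rightarrow> complex) \<Rightarrow> ('b \<Rightarrow> real \<Rightarrow> complex) \<Rightarrow> bool" where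
  "plane_near_cubic_graph G v \<nu> pos curve \<longleftrightarrow>
     near_cubic_graph G v \<nu> \<and> plane_drawing G pos curve \<and> drawn_clockwise G v \<nu> pos curve"

text \<open>
  Functions on a finite set (colorings, precolorings, vectors) are extensional, so that equality
  and counting only see their values on that set.
\<close>

definition three_edge_colorings :: "('a, 'b) pre_digraph \<Rightarrow> 'a \<Rightarrow> ('b \<Rightarrow> nat) set" where
  "three_edge_colorings G v =
     {\<phi> \<in> arcs G \<rightarrow>\<^sub>E {1, 2, 3}.
        \<forall>u \<in> verts G - {v}. inj_on (\<lambda>h. \<phi> (fst h)) (half_edges_at G u)}"

definition precolorings :: "nat \<Rightarrow> (nat \<Rightarrow> nat) set" where
  "precolorings d =
     {\<psi> \<in> {0..<d} \<rightarrow>\<^sub>E {1, 2, 3}.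
        \<forall>c \<in> {1, 2, 3}. card {k \<in> {0..<d}. \<psi> k = c} mod 2 = d mod 2}"

definition extends_precoloring ::
    "('a, 'b) pre_digraph \<Rightarrow> 'a \<Rightarrow> ('b \<times> bool \<Rightarrow> nat) \<Rightarrow> ('b \<Rightarrow> nat) \<Rightarrow> (nat \<Rightarrow> nat) \<Rightarrow> bool" where
  "extends_precoloring G v \<nu> \<phi> \<psi> \<longleftrightarrow> (\<forall>h \<in> half_edges_at G v. \<phi> (fst h) = \<psi> (\<nu> h))"

definition coloring_count_vector ::
    "('a, 'b) pre_digraph \<Rightarrow> 'a \<Rightarrow> ('b \<times> bool \<Rightarrow> nat) \<Rightarrow> (nat \<Rightarrow> nat) \<Rightarrow> real" where
  "coloring_count_vector G v \<nu> =
     (\<lambda>\<psi> \<in> precolorings (vertex_degree G v).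
        real (card {\<phi> \<in> three_edge_colorings G v. extends_precoloring G v \<nu> \<phi> \<psi>}))"

definition signatures :: "nat \<Rightarrow> (nat set \<times> int) set set" where
  "signatures d =
     {S. S \<subseteq> {m. m \<subseteq> {0..<d} \<and> card m = 2} \<times> {-1, 1} \<and>
         (\<forall>p \<in> S. \<forall>q \<in> S. p \<noteq> q \<longrightarrow> fst p \<inter> fst q = {}) \<and>
         \<not> (\<exists>a b c e s1 s2. ({a, b}, s1) \<in> S \<and> ({c, e}, s2) \<in> S \<and> a < c \<and> c < b \<and> b < e)}"

lemma finite_signatures: "finite (signatures d)"
proof (rule finite_subset)
  show "signatures d \<subseteq> Pow ({m. m \<subseteq> {0..<d} \<and> card m = 2} \<times> {-1, 1})"
    by (auto simp: signatures_def)
qed simp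

definition compatible ::
    "nat \<Rightarrow> (nat \<Rightarrow> nat) \<Rightarrow> nat \<Rightarrow> nat \<Rightarrow> (nat set \<times> int) set \<Rightarrow> bool" where
  "compatible d \<psi> i j S \<longleftrightarrow>
     {k \<in> {0..<d}. \<psi> k \<in> {i, j}} = (\<Union>p \<in> S. fst p) \<and>
     (\<forall>a1 a2 s. ({a1, a2}, s) \<in> S \<longrightarrow> (\<psi> a1 = \<psi> a2 \<longleftrightarrow> s = -1))"

definition compatible_signatures ::
    "nat \<Rightarrow> (nat \<Rightarrow> nat) \<Rightarrow> nat \<Rightarrow> nat \<Rightarrow> (nat set \<times> int) set set" where
  "compatible_signatures d \<psi> i j = {S \<in> signatures d. compatible d \<psi> i j S}"

definition coloring_count_cone :: "nat \<Rightarrow> ((nat \<Rightarrow> nat) \<Rightarrow> real) set" where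
  "coloring_count_cone d =
     {x \<in> precolorings d \<rightarrow>\<^sub>E UNIV.
        (\<forall>\<psi> \<in> precolorings d. 0 \<le> x \<psi>) \<and>
        (\<exists>y \<in> signatures d \<rightarrow>\<^sub>E (UNIV :: real set).
           (\<forall>S \<in> signatures d. 0 \<le> y S) \<and>
           (\<forall>\<psi> \<in> precolorings d. \<forall>i \<in> {1, 2, 3}. \<forall>j \<in> {1, 2, 3}. i \<noteq> j \<longrightarrow>
              x \<psi> = (\<Sum>S \<in> compatible_signatures d \<psi> i j. y S)))}"

end

theory Submission
  imports Defs "HOL-Complex_Analysis.Winding_Numbers"
begin

text \<open>
  Fix a 3-edge-coloring and two colors \<open>i\<close>, \<open>j\<close>. The half-edges of these colors form cycles avoiding
  \<open>v\<close> and chains between two half-edges at \<open>v\<close>. The chains pair up the half-edges at \<open>v\<close> of colors \<open>i\<close>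
  and \<open>j\<close>; marking each pair by whether its colors agree gives a signature, which is noncrossing since two
  disjoint chains cannot alternate around \<open>v\<close> in the plane. Exchanging the two colors on a chain and
  permuting the three colors show that the number of colorings that extend \<open>\<psi>\<close> and have signature \<open>S\<close> is
  the same for all \<open>\<psi>\<close>, \<open>i\<close>, \<open>j\<close> compatible with \<open>S\<close>. This common number is the required \<open>y S\<close>.
\<close>

section \<open>Rays in a disc\<close>

text \<open>The cone asks for a single \<open>y\<close> that serves all precolorings and all three
  color pairs at once. A signature may therefore keep only what exchanging two colors on a chain
  leaves unchanged: which ends belong together and whether their colors agree. An exchange alters
  both ends simultaneously, so this agreement is invariant, and it is exactly what compatibility
  tests.

  The planar step is delicate at v, where all chains may meet and the curves, being merely
  continuous, may spiral. Deleting the point of v separates the chains, but the cyclic order is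
  known only where the half-edges first reach a circle. Winding numbers connect the two: they are
  insensitive to the shape of the curves inside the disc, yet distinguish the two circular arcs
  between a pair of first hits.\<close>

definition disc_ray :: "complex \<Rightarrow> real \<Rightarrow> real \<Rightarrow> (real \<Rightarrow> complex) \<Rightarrow> bool" where
  "disc_ray p r \<theta> g \<longleftrightarrow>
     path g \<and> pathstart g = p \<and> pathfinish g = p + of_real r * cis \<theta> \<and>
     (\<forall>t \<in> {0<..<1}. g t \<noteq> p \<and> dist p (g t) < r)"

text \<open>The integral of 1/(w - p) along the arc is i times b - a. The formula for that integral
  is applied only for a < b; a clockwise arc is handled as the reverse of a counterclockwise one,
  and the arcs used later do run clockwise.\<close>

lemma winding_number_part_circlepath_centre:
  assumes "r > 0"
  shows "winding_number (part_circlepath p r a b) p = of_real ((b - a) / (2 * pi))"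
proof -
  have *: "winding_number (part_circlepath p r a b) p = of_real ((b - a) / (2 * pi))"
    if "a < b" for a b
  proof -
    have "p \<notin> path_image (part_circlepath p r a b)"
      using path_image_part_circlepath_subset'[of r p a b] assms by auto
    then have "winding_number (part_circlepath p r a b) p =
        1 / (2 * pi * \<i>) * contour_integral (part_circlepath p r a b) (\<lambda>w. 1 / (w - p))"
      by (simp add: winding_number_valid_path)
    also have "contour_integral (part_circlepath p r a b) (\<lambda>w. 1 / (w - p)) = of_real (b - a) * \<i>"
      using that assms by (simp add: contour_integral_part_circlepath_eq scaleR_conv_of_real)
    finally show ?thesis by simp
  qed
  consider "a < b" | "a = b" | "b < a" by linarith
  then show ?thesis
  proof cases
    case 3
    have "winding_number (reversepath (part_circlepath p r b a)) p =
        - winding_number (part_circlepath p r b a) p"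
      using path_image_part_circlepath_subset'[of r p b a] assms
      by (intro winding_number_reversepath) auto
    with *[OF 3] show ?thesis by (simp add: field_simps)
  next
    case 2
    have "part_circlepath p r b b = linepath (p + r * cis b) (p + r * cis b)"
      by (auto simp: part_circlepath_def linepath_def fun_eq_iff cis_conv_exp algebra_simps
          simp flip: scaleR_add_left)
    then show ?thesis using 2 assms by (simp add: winding_number_trivial)
  qed (rule *)
qed

text \<open>From \<open>g t\<close> one can leave the disc without meeting \<open>N\<close>: follow
  the ray to the circle, then continue radially to \<open>q\<close> outside, where the winding
  number vanishes. The centre is excluded in \<open>disj\<close> because \<open>N\<close> will
  itself pass through it.\<close>

lemma winding_number_disc_ray:
  assumes ray: "disc_ray p r \<theta> g" and r: "r > 0"
    and N: "path N" "pathfinish N = pathstart N" "path_image N \<subseteq> cball p r"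
    and disj: "path_image N \<inter> g ` {0<..1} = {}" and t: "t \<in> {0<..<1}"
  shows "winding_number N (g t) = 0"
proof -
  define q where "q = p + of_real (2 * r) * cis \<theta>"
  let ?e = "p + of_real r * cis \<theta>"
  have g1: "g 1 = ?e" using ray by (simp add: disc_ray_def pathfinish_def)
  have "continuous_on {t..1} g"
    using ray t by (auto simp: disc_ray_def path_def intro: continuous_on_subset)
  then have con: "Topological_Spaces.connected (g ` {t..1} \<union> closed_segment ?e q)"
    using t g1 by (intro connected_Un connected_continuous_image) (auto intro!: exI[of _ ?e] image_eqI[of _ g 1])
  have seg: "closed_segment ?e q \<inter> path_image N = {}"
  proof -
    have "x \<notin> path_image N" if "x \<in> closed_segment ?e q" for x
    proof -
      obtain u where u: "0 \<le> u" "u \<le> 1" "x = (1 - u) *\<^sub>R ?e + u *\<^sub>R q"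
        using \<open>x \<in> _\<close> by (auto simp: in_segment)
      have x: "x = p + of_real ((1 + u) * r) * cis \<theta>"
        using u(3) by (simp add: q_def scaleR_conv_of_real algebra_simps)
      show ?thesis
      proof (cases "u = 0")
        case True
        then have "x \<in> g ` {0<..1}" using x g1 by (auto intro!: image_eqI[of _ g 1])
        then show ?thesis using disj by blast
      next
        case False
        have "dist p x = (1 + u) * r"
          unfolding x using u(1) r by (simp add: dist_norm norm_mult del: of_real_add of_real_mult)
        also have "\<dots> > r" using False u r by simp
        finally show ?thesis using N(3) by auto
      qed
    qed
    then show ?thesis by blast
  qed
  have "g ` {t..1} \<inter> path_image N = {}" using disj t by fastforce
  then have "winding_number N (g t) = winding_number N q"
    using seg t by (intro winding_number_eq[OF N(1,2) _ _ con]) auto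
  also have "\<dots> = 0"
  proof (rule winding_number_zero_outside[OF N(1) convex_cball N(2) _ N(3)])
    show "q \<notin> cball p r" using r by (simp add: q_def dist_norm norm_mult)
  qed
  finally show ?thesis .
qed

lemma cis_eq_within_turn:
  assumes "cis x = cis y" "\<bar>x - y\<bar> < 2 * pi"
  shows "x = y"
proof -
  have "sin x = sin y" "cos x = cos y"
    using assms(1) by (metis cis.sel)+
  then obtain n :: int where "x = y + 2 * pi * n" using sin_cos_eq_iff by blast
  then have "\<bar>2 * pi * n\<bar> < 2 * pi * 1" using assms(2) by simp
  then have "\<bar>real_of_int n\<bar> < 1" by (simp add: abs_mult)
  then have "n = 0" by linarith
  with \<open>x = _\<close> show ?thesis by simp
qed

text \<open>
  The closed curve \<open>A +++ k\<close> through the rays \<open>a\<close> and \<open>b\<close> winds equally often around all points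
  of the other connection, in particular around two points of the rays \<open>c\<close> and \<open>e\<close> close to the
  centre. Replacing \<open>k\<close> by the circular arc \<open>g1\<close> from \<open>a\<close> to \<open>b\<close> changes both winding
  numbers by the same amount, since \<open>k\<close> stays away from the centre. But \<open>A\<close> closed by \<open>g1\<close> does
  not wind around the ray \<open>e\<close>, and \<open>A\<close> closed by the complementary arc \<open>g2\<close> does not wind
  around the ray \<open>c\<close>, whereas the two arcs together make a full turn.
\<close>

lemma disc_rays_not_crossing:
  assumes r: "r > 0"
    and rays: "disc_ray p r \<theta>a ia" "disc_ray p r \<theta>b ib" "disc_ray p r \<theta>c ic" "disc_ray p r \<theta>e ie"
    and X: "path_image ia \<subseteq> insert p X" "path_image ib \<subseteq> insert p X"
           "path_component X (pathfinish ia) (pathfinish ib)"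
    and Y: "path_image ic \<subseteq> insert p Y" "path_image ie \<subseteq> insert p Y"
           "path_component Y (pathfinish ic) (pathfinish ie)"
    and XY: "X \<inter> Y = {}" "p \<notin> X" "p \<notin> Y"
    and order: "\<theta>c < \<theta>a" "\<theta>b < \<theta>c" "\<theta>e < \<theta>b" "\<theta>a - 2 * pi < \<theta>e"
  shows False
proof -
  note ray = rays[unfolded disc_ray_def]
  obtain k where k: "path k" "path_image k \<subseteq> X" "pathstart k = pathfinish ib"
      "pathfinish k = pathfinish ia"
    using path_component_sym[OF X(3)] unfolding path_component_def by blast
  obtain l where l: "path l" "path_image l \<subseteq> Y" "pathstart l = pathfinish ic"
      "pathfinish l = pathfinish ie"
    using Y(3) unfolding path_component_def by blast
  define A where "A = reversepath ia +++ ib"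
  define g1 where "g1 = part_circlepath p r \<theta>a \<theta>b"
  \<comment> \<open>Ending at \<open>\<theta>a - 2 * pi\<close> instead of \<open>\<theta>a\<close>
    lets the second arc continue clockwise, so that the two arcs together make one full negative
    turn.\<close>
  define g2 where "g2 = part_circlepath p r \<theta>b (\<theta>a - 2 * pi)"
  have g1: "path g1" "pathstart g1 = pathfinish ia" "pathfinish g1 = pathfinish ib"
    using ray by (simp_all add: g1_def cis_conv_exp)
  have cis_turn: "cis (\<theta>a - 2 * pi) = cis \<theta>a" by (simp flip: cis_divide)
  have g2: "path g2" "pathstart g2 = pathfinish ib" "pathfinish g2 = pathfinish ia"
    using ray cis_turn by (simp_all add: g2_def cis_conv_exp)
  have A: "path A" "pathstart A = pathfinish ia" "pathfinish A = pathfinish ib"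
      "path_image A = path_image ia \<union> path_image ib"
    using ray by (simp_all add: A_def path_image_join)
  have in_cball: "path_image i \<subseteq> cball p r" if "disc_ray p r \<theta> i" for i \<theta>
  proof -
    have "dist p (i t) \<le> r" if "t \<in> {0..1}" for t
    proof -
      consider "t = 0" | "t = 1" | "t \<in> {0<..<1}" using \<open>t \<in> _\<close> by fastforce
      then show ?thesis
        using \<open>disc_ray p r \<theta> i\<close> r
        by cases (auto simp: disc_ray_def pathstart_def pathfinish_def dist_norm norm_mult less_imp_le)
    qed
    then show ?thesis by (auto simp: path_image_def)
  qed
  have on_circle: "path_image g1 \<subseteq> sphere p r" "path_image g2 \<subseteq> sphere p r"
    using r by (simp_all add: g1_def g2_def path_image_part_circlepath_subset')
  have tail_Y: "i t \<in> Y" if "disc_ray p r \<theta> i" "path_image i \<subseteq> insert p Y" "t \<in> {0<..1}" for i \<theta> t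
  proof -
    have "i t \<noteq> p"
    proof (cases "t = 1")
      case True
      then show ?thesis using that r by (simp add: disc_ray_def pathfinish_def)
    qed (use that in \<open>auto simp: disc_ray_def\<close>)
    moreover have "i t \<in> path_image i" using that(3) by (auto simp: path_image_def)
    ultimately show ?thesis using that(2) by blast
  qed
  \<comment> \<open>A ray meets the circle only at its end, whose angle lies strictly inside the gap
    left by the arc; the gap consists of the angles between \<open>\<alpha>\<close> and
    \<open>\<beta> + 2 * pi\<close>.\<close>
  have tail_circle: "i t \<notin> path_image (part_circlepath p r \<alpha> \<beta>)"
    if i: "disc_ray p r \<theta> i" and t: "t \<in> {0<..1}" and ang: "\<beta> < \<alpha>" "\<alpha> < \<theta> \<and> \<theta> < \<beta> + 2 * pi"
    for i \<theta> t \<alpha> \<beta>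
  proof
    assume *: "i t \<in> path_image (part_circlepath p r \<alpha> \<beta>)"
    then have "dist p (i t) = r"
      using path_image_part_circlepath_subset'[of r p \<alpha> \<beta>] r by auto
    then have "t = 1" using i t by (force simp: disc_ray_def)
    then have "i t = p + of_real r * cis \<theta>" using i by (simp add: disc_ray_def pathfinish_def)
    with * obtain x where x: "x \<in> closed_segment \<alpha> \<beta>" "cis \<theta> = cis x"
      using r by (auto simp: path_image_part_circlepath')
    then have "\<theta> = x" using ang by (intro cis_eq_within_turn) (auto simp: closed_segment_eq_real_ivl)
    then show False using x ang by (auto simp: closed_segment_eq_real_ivl)
  qed
  have p_notin: "p \<notin> path_image (g1 +++ k)"
    using g1 k on_circle(1) r XY by (auto simp: path_image_join)
  moreover have "closed (path_image (g1 +++ k))" using g1 k by (intro closed_path_image) simp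
  ultimately obtain \<delta> where \<delta>: "\<delta> > 0" "ball p \<delta> \<inter> path_image (g1 +++ k) = {}"
    using open_contains_ball[of "- path_image (g1 +++ k)"] by blast
  have near: "\<exists>t \<in> {0<..<1}. i t \<in> ball p \<delta>" if "disc_ray p r \<theta> i" for i \<theta>
  proof -
    have "continuous_on {0..1} i" and i0: "i 0 = p"
      using that by (auto simp: disc_ray_def path_def pathstart_def)
    then obtain \<epsilon> where \<epsilon>: "\<epsilon> > 0" "\<And>t. t \<in> {0..1} \<Longrightarrow> dist t 0 < \<epsilon> \<Longrightarrow> dist (i t) p < \<delta>"
      using \<delta>(1) unfolding continuous_on_iff by (metis atLeastAtMost_iff order_refl zero_le_one)
    have "dist (i (min (1/2) (\<epsilon>/2))) p < \<delta>" using \<epsilon>(1) by (intro \<epsilon>(2)) auto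
    then show ?thesis using \<epsilon>(1) by (intro bexI[of _ "min (1/2) (\<epsilon>/2)"]) (auto simp: dist_commute)
  qed
  obtain s where s: "s \<in> {0<..<1}" "ic s \<in> ball p \<delta>" using near[OF rays(3)] by blast
  obtain t where t: "t \<in> {0<..<1}" "ie t \<in> ball p \<delta>" using near[OF rays(4)] by blast
  let ?zc = "ic s" and ?ze = "ie t"
  have avoid_A: "z \<notin> path_image A" if "z \<in> Y" for z using that X XY A by auto
  have avoid_k: "z \<notin> path_image k" if "z \<in> Y" for z using that k XY by auto
  have zY: "?zc \<in> Y" "?ze \<in> Y" using s t by (auto intro!: tail_Y[OF rays(3) Y(1)] tail_Y[OF rays(4) Y(2)])
  have z_ball: "?zc \<in> ball p r" "?ze \<in> ball p r" using s t ray by auto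
  then have avoid_g: "?zc \<notin> path_image g1" "?ze \<notin> path_image g1"
      "?zc \<notin> path_image g2" "?ze \<notin> path_image g2"
    using on_circle by auto
  have "Topological_Spaces.connected (ic ` {s..1} \<union> path_image l \<union> ie ` {t..1})"
  proof -
    have "continuous_on {s..1} ic" "continuous_on {t..1} ie"
      using ray s t by (auto simp: path_def intro: continuous_on_subset)
    moreover have "pathstart l \<in> ic ` {s..1} \<inter> path_image l"
      "pathfinish l \<in> path_image l \<inter> ie ` {t..1}"
      using l(3,4) s t pathstart_in_path_image[of l] pathfinish_in_path_image[of l]
      by (auto simp: pathfinish_def[of ic] pathfinish_def[of ie])
    ultimately show ?thesis
      using l(1) by (intro connected_Un connected_continuous_image connected_path_image) auto
  qed
  moreover have "ic ` {s..1} \<union> path_image l \<union> ie ` {t..1} \<subseteq> Y"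
    using s t l(2) by (auto intro!: tail_Y[OF rays(3) Y(1)] tail_Y[OF rays(4) Y(2)])
  then have "(ic ` {s..1} \<union> path_image l \<union> ie ` {t..1}) \<inter> path_image (A +++ k) = {}"
    using avoid_A avoid_k A k by (auto simp: path_image_join)
  ultimately have "winding_number (A +++ k) ?zc = winding_number (A +++ k) ?ze"
    using A k s t by (intro winding_number_eq) auto
  moreover have "winding_number (g1 +++ k) ?zc = winding_number (g1 +++ k) ?ze"
    using g1 k s t \<delta>(2) by (intro winding_number_eq[of _ _ "ball p \<delta>"]) auto
  moreover have "winding_number (A +++ reversepath g1) ?ze = 0"
  proof (rule winding_number_disc_ray[OF rays(4) r _ _ _ _ t(1)])
    show "path_image (A +++ reversepath g1) \<subseteq> cball p r"
      using A g1 in_cball rays on_circle by (auto simp: path_image_join)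
    \<comment> \<open>The angle of a ray counts only modulo a full turn. Raised by
      \<open>2 * pi\<close>, \<open>\<theta>e\<close> lies between \<open>\<theta>a\<close> and
      \<open>\<theta>b + 2 * pi\<close>, the gap left by \<open>g1\<close>.\<close>
    have turned: "disc_ray p r (\<theta>e + 2 * pi) ie"
      using rays(4) by (simp add: disc_ray_def flip: cis_mult)
    have "ie u \<notin> path_image g1" if "u \<in> {0<..1}" for u
      using tail_circle[OF turned that, of \<theta>b \<theta>a] order by (simp add: g1_def)
    then show "path_image (A +++ reversepath g1) \<inter> ie ` {0<..1} = {}"
      using A g1 avoid_A tail_Y[OF rays(4) Y(2)] by (auto simp: path_image_join)
  qed (use A g1 in auto)
  moreover have "winding_number (A +++ g2) ?zc = 0"
  proof (rule winding_number_disc_ray[OF rays(3) r _ _ _ _ s(1)])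
    show "path_image (A +++ g2) \<subseteq> cball p r"
      using A g2 in_cball rays on_circle by (auto simp: path_image_join)
    have "ic u \<notin> path_image g2" if "u \<in> {0<..1}" for u
      using tail_circle[OF rays(3) that, of "\<theta>a - 2 * pi" \<theta>b] order unfolding g2_def by simp
    then show "path_image (A +++ g2) \<inter> ic ` {0<..1} = {}"
      using A g2 avoid_A tail_Y[OF rays(3) Y(1)] by (auto simp: path_image_join)
  qed (use A g2 in auto)
  moreover have "winding_number (g1 +++ g2) ?zc = winding_number (g1 +++ g2) p"
    using g1 g2 on_circle z_ball r
    by (intro winding_number_eq[of _ _ "ball p r"]) (auto simp: path_image_join)
  moreover have "winding_number (g1 +++ g2) p = -1"
  proof -
    have "winding_number (g1 +++ g2) p = winding_number g1 p + winding_number g2 p"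
      using g1 g2 on_circle r by (intro winding_number_join) auto
    also have "\<dots> = of_real ((\<theta>b - \<theta>a) / (2 * pi) + (\<theta>a - 2 * pi - \<theta>b) / (2 * pi))"
      using r by (simp add: g1_def g2_def winding_number_part_circlepath_centre)
    also have "(\<theta>b - \<theta>a) / (2 * pi) + (\<theta>a - 2 * pi - \<theta>b) / (2 * pi) = -1"
      by (simp add: field_simps)
    finally show ?thesis by simp
  qed
  \<comment> \<open>\<open>A\<close> and \<open>g1\<close> wind equally around \<open>?ze\<close>.
    Comparing \<open>?ze\<close> with \<open>?zc\<close> transfers this to \<open>?zc\<close>, which
    is the first equation; the other two then read 0 = -1.\<close>
  ultimately have
      "winding_number A ?zc + winding_number k ?zc = winding_number g1 ?zc + winding_number k ?zc"
      "winding_number A ?zc + winding_number g2 ?zc = 0"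
      "winding_number g1 ?zc + winding_number g2 ?zc = -1"
    using A g1 g2 k zY avoid_A avoid_k avoid_g
    by (simp_all add: winding_number_join winding_number_reversepath)
  then show False by simp
qed

section \<open>Kempe chains\<close>

text \<open>
  If \<open>x0, \<dots>\<close> is the orbit of \<open>x0\<close> under \<open>\<beta> \<circ> \<alpha>\<close>, of length \<open>n\<close>, then on its indices modulo \<open>n\<close> the
  involution \<open>\<beta>\<close> acts as \<open>k \<mapsto> -k\<close> and \<open>\<alpha>\<close> as \<open>k \<mapsto> -1 - k\<close>. As \<open>\<alpha>\<close> has no fixed point, \<open>n\<close> is even,
  and the second fixed point of \<open>\<beta>\<close> has index \<open>n / 2\<close>.
\<close>

lemma fixed_points_of_involutions:
  fixes \<alpha> \<beta> :: "'x \<Rightarrow> 'x"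
  assumes fin: "finite X"
    and \<alpha>: "\<And>x. x \<in> X \<Longrightarrow> \<alpha> x \<in> X" "\<And>x. x \<in> X \<Longrightarrow> \<alpha> (\<alpha> x) = x" "\<And>x. x \<in> X \<Longrightarrow> \<alpha> x \<noteq> x"
    and \<beta>: "\<And>x. x \<in> X \<Longrightarrow> \<beta> x \<in> X" "\<And>x. x \<in> X \<Longrightarrow> \<beta> (\<beta> x) = x"
    and x0: "x0 \<in> X" "\<beta> x0 = x0"
  shows "\<exists>!x1. x1 \<noteq> x0 \<and> \<beta> x1 = x1 \<and> (x0, x1) \<in> {(x, y). x \<in> X \<and> (y = \<alpha> x \<or> y = \<beta> x)}\<^sup>*"
    (is "\<exists>!x1. _ \<and> _ \<and> (x0, x1) \<in> ?R\<^sup>*")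
proof -
  define f where "f k = ((\<beta> \<circ> \<alpha>) ^^ k) x0" for k
  have f0: "f 0 = x0" and fSuc: "f (Suc k) = \<beta> (\<alpha> (f k))" for k by (simp_all add: f_def)
  have fX: "f k \<in> X" for k by (induction k) (simp_all add: f0 fSuc x0 \<alpha> \<beta>)
  have step: "x = y" if "\<beta> (\<alpha> x) = \<beta> (\<alpha> y)" "x \<in> X" "y \<in> X" for x y
    using that by (metis \<alpha>(1,2) \<beta>(2))
  \<comment> \<open>Since \<open>\<beta> \<circ> \<alpha>\<close> is injective on \<open>X\<close>,
    common steps can be cancelled: any repetition in the orbit yields a return to \<open>x0\<close>
    itself.\<close>
  have shift: "f a = f (a + c) \<Longrightarrow> f 0 = f c" for a c
    by (induction a) (auto simp: fSuc fX dest: step)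
  have "\<not> inj f"
    using fX fin by (metis finite_subset finite_imageD image_subsetI infinite_UNIV_nat)
  then obtain a b where "a < b" "f a = f b" by (metis inj_def linorder_neqE_nat)
  then have "\<exists>n > 0. f n = x0" using shift[of a "b - a"] f0 by (intro exI[of _ "b - a"]) auto
  define n where "n = (LEAST n. 0 < n \<and> f n = x0)"
  have n: "0 < n" "f n = x0"
    using LeastI_ex[OF \<open>\<exists>n > 0. f n = x0\<close>] by (auto simp: n_def)
  have least: "m = 0" if "f m = x0" "m < n" for m
    using not_less_Least[of m "\<lambda>n. 0 < n \<and> f n = x0", folded n_def] that by auto
  have inj: "k = m" if "f k = f m" "k < n" "m < n" for k m
    using that
  proof (induction k m rule: linorder_wlog)
    case (le k m)
    then have "f (m - k) = x0" using shift[of k "m - k"] f0 by simp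
    then show ?case using least le by fastforce
  qed auto
  have \<alpha>f: "\<alpha> (f k) = f (n - Suc k)" if "k < n" for k
    using that
  proof (induction k)
    case 0
    have "\<beta> (\<alpha> (\<alpha> x0)) = \<beta> (\<alpha> (f (n - 1)))"
      using n x0 \<alpha>(2) fSuc[of "n - 1"] by simp
    then show ?case using step f0 \<alpha>(1) x0 fX by (metis One_nat_def)
  next
    case (Suc k)
    then have "n - Suc k = Suc (n - Suc (Suc k))" by simp
    then have "\<alpha> (f k) = \<beta> (\<alpha> (f (n - Suc (Suc k))))" using Suc fSuc by simp
    then show ?case using fSuc \<alpha> \<beta> fX by simp
  qed
  have \<beta>f: "\<beta> (f k) = f (n - k)" if "k < n" for k
  proof -
    have "f (n - k) = \<beta> (\<alpha> (f (n - Suc k)))"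
      using fSuc[of "n - Suc k"] that by (simp add: Suc_diff_Suc)
    also have "\<alpha> (f (n - Suc k)) = f k" using \<alpha>f[OF that] \<alpha>(2) fX by metis
    finally show ?thesis by simp
  qed
  have reach: "(x0, f k) \<in> ?R\<^sup>*" for k
  proof (induction k)
    case (Suc k)
    moreover have "(f k, \<alpha> (f k)) \<in> ?R" "(\<alpha> (f k), f (Suc k)) \<in> ?R" using fX fSuc \<alpha> by auto
    ultimately show ?case by (meson rtrancl.rtrancl_into_rtrancl)
  qed (simp add: f0)
  \<comment> \<open>\<open>?R\<close> applies \<open>\<alpha>\<close> or \<open>\<beta>\<close>
    alone, but by the reflection formulas neither leaves the cycle. Index 0 is separate because
    \<open>\<beta>f\<close> would send it to \<open>n\<close>, which is out of range.\<close>
  have orbit: "\<exists>k < n. x = f k" if "(x0, x) \<in> ?R\<^sup>*" for x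
    using that
  proof induction
    case base
    then show ?case using n f0 by auto
  next
    case (step y z)
    then obtain k where k: "k < n" "y = f k" "z = \<alpha> y \<or> z = \<beta> y" by auto
    then show ?case
    proof (cases "k = 0")
      case True
      then show ?thesis using k n f0 x0 \<alpha>f by (metis diff_less zero_less_Suc)
    next
      case False
      then show ?thesis using k \<alpha>f \<beta>f by (metis diff_less n(1) not_gr0 zero_less_Suc)
    qed
  qed
  have "even n"
  proof (rule ccontr)
    assume "odd n"
    then obtain m where "n = Suc (2 * m)" by (metis oddE Suc_eq_plus1)
    then have "\<alpha> (f m) = f m" using \<alpha>f[of m] by simp
    then show False using \<alpha>(3) fX by blast
  qed
  then obtain m where m: "n = 2 * m" by (elim evenE)
  show ?thesis
  proof (rule ex1I[of _ "f m"], intro conjI)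
    show "f m \<noteq> x0" using least[of m] m n by auto
    show "\<beta> (f m) = f m" using \<beta>f[of m] m n by simp
    show "(x0, f m) \<in> ?R\<^sup>*" by (rule reach)
  next
    fix x assume x: "x \<noteq> x0 \<and> \<beta> x = x \<and> (x0, x) \<in> ?R\<^sup>*"
    then obtain k where k: "k < n" "x = f k" using orbit by blast
    with x f0 have "0 < k" by (cases k) auto
    then have "n - k = k" using inj[of "n - k" k] \<beta>f[of k] x k by simp
    then have "k = m" using k(1) m by linarith
    then show "x = f m" using k by simp
  qed
qed

section \<open>Chains of two colors, their ends at v, and the resulting signature\<close>

definition kempe_half_edges :: "('a, 'b) pre_digraph \<Rightarrow> ('b \<Rightarrow> nat) \<Rightarrow> nat \<Rightarrow> nat \<Rightarrow> ('b \<times> bool) set" where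
  "kempe_half_edges G \<phi> i j = {h \<in> arcs G \<times> UNIV. \<phi> (fst h) \<in> {i, j}}"

text \<open>A chain is a class of the reflexive transitive closure. Passing through v is forbidden,
  so chains end there. The coloring enters only through \<open>H\<close>, so a recoloring that
  preserves \<open>H\<close> preserves all chains.\<close>

definition kempe_link :: "('a, 'b) pre_digraph \<Rightarrow> 'a \<Rightarrow> ('b \<times> bool) set \<Rightarrow> ('b \<times> bool) rel" where
  "kempe_link G v H =
     {(h, h') \<in> H \<times> H. fst h = fst h' \<or>
        (half_edge_end G h = half_edge_end G h' \<and> half_edge_end G h \<noteq> v)}"

definition kempe_pairs :: "('a, 'b) pre_digraph \<Rightarrow> 'a \<Rightarrow> ('b \<times> bool) set \<Rightarrow> ('b \<times> bool) rel" where
  "kempe_pairs G v H =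
     {(h, h'). h \<in> H \<inter> half_edges_at G v \<and> h' \<in> H \<inter> half_edges_at G v \<and> h \<noteq> h' \<and>
        (h, h') \<in> (kempe_link G v H)\<^sup>*}"

text \<open>Each chain occurs in \<open>kempe_pairs\<close> in both orders, and both give the same
  element. A loop at v is a chain whose ends are its own two half-edges.\<close>

definition kempe_signature ::
    "('a, 'b) pre_digraph \<Rightarrow> 'a \<Rightarrow> ('b \<times> bool \<Rightarrow> nat) \<Rightarrow> nat \<Rightarrow> nat \<Rightarrow> ('b \<Rightarrow> nat) \<Rightarrow> (nat set \<times> int) set" where
  "kempe_signature G v \<nu> i j \<phi> =
     (\<lambda>(h, h'). ({\<nu> h, \<nu> h'}, if \<phi> (fst h) = \<phi> (fst h') then -1 else 1)) `
       kempe_pairs G v (kempe_half_edges G \<phi> i j)"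

lemma sym_kempe_link_rtrancl: "sym ((kempe_link G v H)\<^sup>*)"
  by (intro sym_rtrancl) (auto simp: sym_def kempe_link_def)

lemma sym_kempe_pairs: "sym (kempe_pairs G v H)"
  using sym_kempe_link_rtrancl[of G v H] by (auto simp: sym_def kempe_pairs_def)

locale near_cubic =
  fixes G :: "('a, 'b) pre_digraph" and v :: 'a and \<nu> :: "'b \<times> bool \<Rightarrow> nat"
  assumes near_cubic: "near_cubic_graph G v \<nu>"
begin

sublocale fin_digraph G using near_cubic by (simp add: near_cubic_graph_def)

lemma half_edge_end_in_verts: "h \<in> arcs G \<times> UNIV \<Longrightarrow> half_edge_end G h \<in> verts G"
  by (auto simp: half_edge_end_def)

lemma \<nu>_bij: "bij_betw \<nu> (half_edges_at G v) {0..<vertex_degree G v}"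
  using near_cubic by (simp add: near_cubic_graph_def)

lemma \<nu>_inj: "h \<in> half_edges_at G v \<Longrightarrow> h' \<in> half_edges_at G v \<Longrightarrow> \<nu> h = \<nu> h' \<longleftrightarrow> h = h'"
  using \<nu>_bij by (auto simp: bij_betw_def inj_on_def)

lemma \<nu>_less: "h \<in> half_edges_at G v \<Longrightarrow> \<nu> h < vertex_degree G v"
  using \<nu>_bij by (auto simp: bij_betw_def)

lemma \<nu>_surj: "k < vertex_degree G v \<Longrightarrow> \<exists>h \<in> half_edges_at G v. \<nu> h = k"
  using \<nu>_bij by (metis atLeastLessThan_iff bij_betw_imp_surj_on imageE le0)

lemma color_range: "\<phi> \<in> three_edge_colorings G v \<Longrightarrow> e \<in> arcs G \<Longrightarrow> \<phi> e \<in> {1, 2, 3}"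
  by (auto simp: three_edge_colorings_def PiE_def Pi_def)

text \<open>The three half-edges at a vertex other than v show all three colors, so exactly one of
  them carries the color of i, j that \<open>h\<close> does not have.\<close>

lemma ex1_kempe_neighbour:
  assumes \<phi>: "\<phi> \<in> three_edge_colorings G v"
    and ij: "i \<in> {1, 2, 3}" "j \<in> {1, 2, 3}" "i \<noteq> j"
    and h: "h \<in> kempe_half_edges G \<phi> i j" "half_edge_end G h \<noteq> v"
  shows "\<exists>!h'. h' \<noteq> h \<and> h' \<in> kempe_half_edges G \<phi> i j \<and> half_edge_end G h' = half_edge_end G h"
proof -
  let ?u = "half_edge_end G h" and ?c = "\<lambda>h. \<phi> (fst h)"
  have u: "?u \<in> verts G - {v}" using h half_edge_end_in_verts by (auto simp: kempe_half_edges_def)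
  then have inj: "inj_on ?c (half_edges_at G ?u)" and "card (half_edges_at G ?u) = 3"
    using \<phi> near_cubic by (auto simp: three_edge_colorings_def near_cubic_graph_def vertex_degree_def)
  then have "card (?c ` half_edges_at G ?u) = 3" by (simp add: card_image)
  moreover have "?c ` half_edges_at G ?u \<subseteq> {1, 2, 3}"
    using color_range[OF \<phi>] by (force simp: half_edges_at_def)
  ultimately have img: "?c ` half_edges_at G ?u = {1, 2, 3}" by (intro card_subset_eq) auto
  have hu: "h \<in> half_edges_at G ?u" using h by (auto simp: kempe_half_edges_def half_edges_at_def)
  define c where "c = (if ?c h = i then j else i)"
  have c: "c \<in> {1, 2, 3}" "c \<in> {i, j}" "c \<noteq> ?c h" using ij by (auto simp: c_def)
  then obtain h' where h': "h' \<in> half_edges_at G ?u" "?c h' = c" using img by (metis imageE)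
  show ?thesis
  proof (rule ex1I[of _ h'])
    show "h' \<noteq> h \<and> h' \<in> kempe_half_edges G \<phi> i j \<and> half_edge_end G h' = ?u"
      using h' c by (auto simp: kempe_half_edges_def half_edges_at_def)
  next
    fix h'' assume *: "h'' \<noteq> h \<and> h'' \<in> kempe_half_edges G \<phi> i j \<and> half_edge_end G h'' = ?u"
    then have h'': "h'' \<in> half_edges_at G ?u" by (auto simp: kempe_half_edges_def half_edges_at_def)
    then have "?c h'' \<noteq> ?c h" using inj hu * by (auto dest: inj_onD)
    then have "?c h'' = c" using * h(1) by (auto simp: kempe_half_edges_def c_def)
    then show "h'' = h'" using h' h'' inj by (auto dest: inj_onD)
  qed
qed

text \<open>The two involutions are \<open>\<alpha>\<close>, which changes to the other half of an
  edge and has no fixed point even on loops, and \<open>\<beta>\<close>, which passes through a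
  vertex and fixes precisely the half-edges at v. The partner is the second fixed point of
  \<open>\<beta>\<close> on the chain.\<close>

lemma ex1_kempe_partner:
  assumes \<phi>: "\<phi> \<in> three_edge_colorings G v"
    and ij: "i \<in> {1, 2, 3}" "j \<in> {1, 2, 3}" "i \<noteq> j"
    and h: "h \<in> kempe_half_edges G \<phi> i j" "h \<in> half_edges_at G v"
  shows "\<exists>!h'. (h, h') \<in> kempe_pairs G v (kempe_half_edges G \<phi> i j)"
proof -
  define H where "H = kempe_half_edges G \<phi> i j"
  define \<alpha> :: "'b \<times> bool \<Rightarrow> 'b \<times> bool" where "\<alpha> h = (fst h, \<not> snd h)" for h
  define nb where "nb h = (THE h'. h' \<noteq> h \<and> h' \<in> H \<and> half_edge_end G h' = half_edge_end G h)" for h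
  define \<beta> where "\<beta> h = (if half_edge_end G h = v then h else nb h)" for h
  note nbr = ex1_kempe_neighbour[OF \<phi> ij, folded H_def]
  have nb: "nb h \<noteq> h" "nb h \<in> H" "half_edge_end G (nb h) = half_edge_end G h"
    if "h \<in> H" "half_edge_end G h \<noteq> v" for h
    using theI'[OF nbr[OF that]] by (auto simp: nb_def)
  have nb_eq: "h' = nb h"
    if "h \<in> H" "half_edge_end G h \<noteq> v" "h' \<noteq> h" "h' \<in> H" "half_edge_end G h' = half_edge_end G h"
    for h h'
    using the1_equality[OF nbr[OF that(1,2)], of h'] that by (simp add: nb_def)
  have \<alpha>H: "\<alpha> x \<in> H" and arcs: "x \<in> arcs G \<times> UNIV" if "x \<in> H" for x
    using that by (auto simp: \<alpha>_def H_def kempe_half_edges_def)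
  have nb_nb: "nb (nb x) = x" if "x \<in> H" "half_edge_end G x \<noteq> v" for x
    using nb[OF that] nb_eq[of "nb x" x] that by metis
  have \<beta>H: "\<beta> x \<in> H" and \<beta>\<beta>: "\<beta> (\<beta> x) = x" if "x \<in> H" for x
    using that nb[OF that] nb_nb[OF that] by (auto simp: \<beta>_def)
  let ?R = "{(x, y). x \<in> H \<and> (y = \<alpha> x \<or> y = \<beta> x)}"
  have "finite H"
    by (rule finite_subset[of _ "arcs G \<times> UNIV"]) (auto simp: H_def kempe_half_edges_def)
  then have "\<exists>!h'. h' \<noteq> h \<and> \<beta> h' = h' \<and> (h, h') \<in> ?R\<^sup>*"
  proof (rule fixed_points_of_involutions)
    show "\<beta> h = h" "h \<in> H" using h by (simp_all add: \<beta>_def half_edges_at_def H_def)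
  qed (use \<alpha>H \<beta>H \<beta>\<beta> in \<open>simp_all add: \<alpha>_def prod_eq_iff\<close>)
  moreover have "?R\<^sup>* = (kempe_link G v H)\<^sup>*"
  proof (rule rtrancl_subset[symmetric])
    show "?R \<subseteq> kempe_link G v H"
    proof (rule subrelI)
      fix x y assume "(x, y) \<in> ?R"
      then have x: "x \<in> H" and "y = \<alpha> x \<or> y = \<beta> x" by auto
      then show "(x, y) \<in> kempe_link G v H"
        using \<alpha>H[OF x] nb[OF x] by (auto simp: kempe_link_def \<alpha>_def \<beta>_def)
    qed
    show "kempe_link G v H \<subseteq> ?R\<^sup>*"
    proof (rule subrelI)
      fix x y assume xy: "(x, y) \<in> kempe_link G v H"
      then have x: "x \<in> H" "y \<in> H" and
        "fst y = fst x \<or> half_edge_end G y = half_edge_end G x \<and> half_edge_end G x \<noteq> v"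
        by (auto simp: kempe_link_def)
      then consider "fst y = fst x"
        | "half_edge_end G y = half_edge_end G x" "half_edge_end G x \<noteq> v" by blast
      then have "y = x \<or> y = \<alpha> x \<or> y = \<beta> x"
      proof cases
        case 1
        then show ?thesis by (cases x; cases y) (auto simp: \<alpha>_def)
      next
        case 2
        then show ?thesis using nb_eq[OF x(1) _ _ x(2)] by (auto simp: \<beta>_def)
      qed
      then consider "y = x" | "(x, y) \<in> ?R" using x by blast
      then show "(x, y) \<in> ?R\<^sup>*" by cases blast+
    qed
  qed
  moreover have "(h, h') \<in> kempe_pairs G v H \<longleftrightarrow> h' \<noteq> h \<and> \<beta> h' = h' \<and> (h, h') \<in> (kempe_link G v H)\<^sup>*" for h'
  proof -
    have "h' \<in> H" if "(h, h') \<in> (kempe_link G v H)\<^sup>*"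
      using that h(1) by cases (simp_all add: kempe_link_def H_def)
    moreover have "h' \<in> half_edges_at G v \<longleftrightarrow> \<beta> h' = h'" if "h' \<in> H"
      using nb(1)[OF that] arcs[OF that] by (simp add: \<beta>_def half_edges_at_def)
    ultimately show ?thesis using h by (auto simp: kempe_pairs_def H_def)
  qed
  ultimately show ?thesis by (simp add: H_def)
qed

lemma kempe_pairs_unique:
  assumes "\<phi> \<in> three_edge_colorings G v"
    and "i \<in> {1, 2, 3}" "j \<in> {1, 2, 3}" "i \<noteq> j"
    and "(h, h1) \<in> kempe_pairs G v (kempe_half_edges G \<phi> i j)"
    and "(h, h2) \<in> kempe_pairs G v (kempe_half_edges G \<phi> i j)"
  shows "h1 = h2"
proof -
  have "h \<in> kempe_half_edges G \<phi> i j" "h \<in> half_edges_at G v"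
    using assms(5) by (auto simp: kempe_pairs_def)
  then show ?thesis using ex1_kempe_partner[OF assms(1-4)] assms(5,6) by blast
qed

text \<open>The pairs cover every half-edge at v colored i or j because each has a partner, and the
  sign was read off from the colors at v, which are those of \<open>\<psi>\<close>.\<close>

lemma compatible_kempe_signature:
  assumes \<phi>: "\<phi> \<in> three_edge_colorings G v" "extends_precoloring G v \<nu> \<phi> \<psi>"
    and ij: "i \<in> {1, 2, 3}" "j \<in> {1, 2, 3}" "i \<noteq> j"
  shows "compatible (vertex_degree G v) \<psi> i j (kempe_signature G v \<nu> i j \<phi>)"
proof -
  define H where "H = kempe_half_edges G \<phi> i j"
  have H: "h \<in> H \<longleftrightarrow> \<psi> (\<nu> h) \<in> {i, j}" and \<phi>\<psi>: "\<phi> (fst h) = \<psi> (\<nu> h)"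
    if "h \<in> half_edges_at G v" for h
    using that \<phi>(2) by (auto simp: H_def kempe_half_edges_def extends_precoloring_def half_edges_at_def)
  have "{k \<in> {0..<vertex_degree G v}. \<psi> k \<in> {i, j}} = (\<Union>p \<in> kempe_signature G v \<nu> i j \<phi>. fst p)"
    (is "?L = ?R")
  proof (intro equalityI subsetI)
    fix k assume "k \<in> ?L"
    then obtain h where h: "h \<in> half_edges_at G v" "\<nu> h = k" "h \<in> H"
      using \<nu>_surj[of k] H by auto
    then obtain h' where "(h, h') \<in> kempe_pairs G v H"
      using ex1_kempe_partner[OF \<phi>(1) ij, of h] by (auto simp: H_def)
    then show "k \<in> ?R" using h by (force simp: kempe_signature_def H_def)
  next
    fix k assume "k \<in> ?R"
    then obtain h where "h \<in> half_edges_at G v" "h \<in> H" "k = \<nu> h"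
      by (auto simp: kempe_signature_def kempe_pairs_def H_def)
    then show "k \<in> ?L" using H \<nu>_less by auto
  qed
  moreover have "\<psi> a1 = \<psi> a2 \<longleftrightarrow> s = -1" if "({a1, a2}, s) \<in> kempe_signature G v \<nu> i j \<phi>" for a1 a2 s
  proof -
    obtain h h' where h: "(h, h') \<in> kempe_pairs G v H" "{a1, a2} = {\<nu> h, \<nu> h'}"
        "s = (if \<phi> (fst h) = \<phi> (fst h') then -1 else 1)"
      using \<open>({a1, a2}, s) \<in> _\<close> by (auto simp: kempe_signature_def H_def)
    then have "\<psi> a1 = \<psi> a2 \<longleftrightarrow> \<psi> (\<nu> h) = \<psi> (\<nu> h')" by (auto simp: doubleton_eq_iff)
    then show ?thesis using h(1,3) \<phi>\<psi> by (auto simp: kempe_pairs_def)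
  qed
  ultimately show ?thesis by (auto simp: compatible_def)
qed

end

lemma compatible_sign: "compatible d \<psi> i j S \<Longrightarrow> ({a, b}, s) \<in> S \<Longrightarrow> \<psi> a = \<psi> b \<longleftrightarrow> s = -1"
  unfolding compatible_def by blast

section \<open>Counting the colorings with a prescribed signature\<close>

context near_cubic begin

definition colorings_with ::
    "nat \<Rightarrow> nat \<Rightarrow> (nat \<Rightarrow> nat) \<Rightarrow> (nat set \<times> int) set \<Rightarrow> ('b \<Rightarrow> nat) set" where
  "colorings_with i j \<psi> S =
     {\<phi> \<in> three_edge_colorings G v. extends_precoloring G v \<nu> \<phi> \<psi> \<and> kempe_signature G v \<nu> i j \<phi> = S}"

lemma finite_three_edge_colorings: "finite (three_edge_colorings G v)"
  by (rule finite_subset[of _ "arcs G \<rightarrow>\<^sub>E {1, 2, 3}"])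
    (auto simp: three_edge_colorings_def intro: finite_PiE)

lemma finite_colorings_with: "finite (colorings_with i j \<psi> S)"
  by (rule finite_subset[OF _ finite_three_edge_colorings]) (auto simp: colorings_with_def)

text \<open>
  Recoloring every chain of colors \<open>i\<close>, \<open>j\<close> in one of the two possible ways by \<open>i'\<close>, \<open>j'\<close>, as
  prescribed at \<open>v\<close> by \<open>\<psi>'\<close>, is an injection; whether a chain is to be flipped can be decided
  at either of its ends because both precolorings are compatible with \<open>S\<close>.
\<close>

lemma card_colorings_with_le:
  assumes ij: "i \<in> {1, 2, 3}" "j \<in> {1, 2, 3}" "i \<noteq> j"
    and ij': "i' \<in> {1, 2, 3}" "j' \<in> {1, 2, 3}" "i' \<noteq> j'"
    and \<psi>: "\<psi> \<in> {0..<vertex_degree G v} \<rightarrow> {1, 2, 3}" "compatible (vertex_degree G v) \<psi> i j S"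
    and \<psi>': "\<psi>' \<in> {0..<vertex_degree G v} \<rightarrow> {1, 2, 3}" "compatible (vertex_degree G v) \<psi>' i' j' S"
  shows "card (colorings_with i j \<psi> S) \<le> card (colorings_with i' j' \<psi>' S)"
proof -
  define d where "d = vertex_degree G v"
  \<comment> \<open>The colors sum to 6, so \<open>6 - i' - j'\<close> is the third color.
    \<open>p\<close> and \<open>q\<close> are the two bijections of colors that send i, j to i',
    j'.\<close>
  define p where "p c = (if c = i then i' else if c = j then j' else 6 - i' - j')" for c
  define q where "q c = (if c = i then j' else if c = j then i' else 6 - i' - j')" for c
  have third: "6 - i' - j' \<in> {1, 2, 3}" "6 - i' - j' \<notin> {i', j'}" using ij' by auto
  have p_range: "p c \<in> {1, 2, 3}" and q_range: "q c \<in> {1, 2, 3}" for c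
    using ij' third(1) by (auto simp: p_def q_def)
  have p_ij: "p c \<in> {i', j'} \<longleftrightarrow> c \<in> {i, j}" and q_ij: "q c \<in> {i', j'} \<longleftrightarrow> c \<in> {i, j}" for c
    using third(2) by (auto simp: p_def q_def)
  have pq: "c \<notin> {i, j} \<Longrightarrow> q c = p c" for c by (simp add: p_def q_def)
  have pq_swap: "c \<in> {i, j} \<Longrightarrow> c' \<in> {i', j'} \<Longrightarrow> p c \<noteq> c' \<Longrightarrow> q c = c'" for c c'
    using ij by (auto simp: p_def q_def)
  have third_unique: "a = b" if "a \<in> {1, 2, 3}" "b \<in> {1, 2, 3}" "a \<notin> {x, y}" "b \<notin> {x, y}"
      "x \<in> {1, 2, 3}" "y \<in> {1, 2, 3}" "x \<noteq> y" for a b x y :: nat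
    using that by (elim insertE emptyE) simp_all
  have p_inj: "a = b" if "p a = p b" "a \<in> {1, 2, 3}" "b \<in> {1, 2, 3}" for a b
  proof (cases "a \<in> {i, j}")
    case True
    then have "b \<in> {i, j}" using p_ij that(1) by metis
    with True show ?thesis using that(1) ij(3) ij'(3) by (elim insertE emptyE) (simp_all add: p_def)
  next
    case False
    then have "b \<notin> {i, j}" using p_ij that(1) by metis
    with False show ?thesis using third_unique[OF that(2,3) _ _ ij] by blast
  qed
  have q_inj: "a = b" if "q a = q b" "a \<in> {1, 2, 3}" "b \<in> {1, 2, 3}" for a b
  proof (cases "a \<in> {i, j}")
    case True
    then have "b \<in> {i, j}" using q_ij that(1) by metis
    with True show ?thesis using that(1) ij(3) ij'(3) by (elim insertE emptyE) (simp_all add: q_def)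
  next
    case False
    then have "b \<notin> {i, j}" using q_ij that(1) by metis
    with False show ?thesis using third_unique[OF that(2,3) _ _ ij] by blast
  qed
  \<comment> \<open>\<open>W\<close> marks the ends where plain renaming by \<open>p\<close> misses
    \<open>\<psi>'\<close>. Chains meeting \<open>W\<close> are recolored by \<open>q\<close>; all
    others, including the cycles, which have no end to decide, by \<open>p\<close>.\<close>
  define W where "W = {h \<in> half_edges_at G v. p (\<psi> (\<nu> h)) \<noteq> \<psi>' (\<nu> h)}"
  define flipped where "flipped H = {e. \<exists>b. \<exists>h \<in> W. ((e, b), h) \<in> (kempe_link G v H)\<^sup>*}" for H
  define H where "H \<phi> = kempe_half_edges G \<phi> i j" for \<phi>
  define recolor where
    "recolor \<phi> = (\<lambda>e \<in> arcs G. if e \<in> flipped (H \<phi>) then q (\<phi> e) else p (\<phi> e))" for \<phi>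
  have ends: "\<psi> (\<nu> h) \<in> {1, 2, 3}" "\<psi>' (\<nu> h) \<in> {1, 2, 3}" "\<psi> (\<nu> h) \<in> {i, j} \<longleftrightarrow> \<psi>' (\<nu> h) \<in> {i', j'}"
    if "h \<in> half_edges_at G v" for h
  proof -
    have "\<nu> h \<in> {0..<d}" using \<nu>_less[OF that] by (simp add: d_def)
    then show "\<psi> (\<nu> h) \<in> {1, 2, 3}" "\<psi>' (\<nu> h) \<in> {1, 2, 3}" using \<psi>(1) \<psi>'(1) d_def by blast+
    have "{k \<in> {0..<d}. \<psi> k \<in> {i, j}} = {k \<in> {0..<d}. \<psi>' k \<in> {i', j'}}"
      using \<psi>(2) \<psi>'(2) by (simp add: compatible_def d_def)
    then show "\<psi> (\<nu> h) \<in> {i, j} \<longleftrightarrow> \<psi>' (\<nu> h) \<in> {i', j'}" using \<open>\<nu> h \<in> _\<close> by blast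
  qed
  have ends_third: "p (\<psi> (\<nu> h)) = \<psi>' (\<nu> h)" if "h \<in> half_edges_at G v" "\<psi> (\<nu> h) \<notin> {i, j}" for h
    using third_unique[OF p_range ends(2)[OF that(1)] _ _ ij'] p_ij ends(3)[OF that(1)] that(2) by blast
  have recolor_ij: "recolor \<phi> e \<in> {i', j'} \<longleftrightarrow> \<phi> e \<in> {i, j}" if "e \<in> arcs G" for e \<phi>
    using that p_ij[of "\<phi> e"] q_ij[of "\<phi> e"] by (simp add: recolor_def)
  \<comment> \<open>The new coloring thus determines \<open>H \<phi>\<close>, hence the flipped
    edges, so recoloring can be undone edge by edge; this gives injectivity.\<close>
  have H_recolor: "kempe_half_edges G (recolor \<phi>) i' j' = H \<phi>" for \<phi>
    unfolding kempe_half_edges_def H_def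
    by (intro Collect_cong conj_cong refl recolor_ij) (simp add: mem_Times_iff)
  have H_closed: "x \<in> H \<phi> \<longleftrightarrow> y \<in> H \<phi>" if "(x, y) \<in> (kempe_link G v (H \<phi>))\<^sup>*" for x y \<phi>
    using that by induction (auto simp: kempe_link_def)
  show ?thesis
  proof (rule card_inj_on_le[of recolor])
    show "inj_on recolor (colorings_with i j \<psi> S)"
    proof (rule inj_onI)
      fix \<phi> \<phi>' assume \<phi>: "\<phi> \<in> colorings_with i j \<psi> S" "\<phi>' \<in> colorings_with i j \<psi> S"
        and eq: "recolor \<phi> = recolor \<phi>'"
      have "H \<phi> = H \<phi>'" using eq H_recolor by metis
      have "\<phi> e = \<phi>' e" if e: "e \<in> arcs G" for e
      proof -
        have range: "\<phi> e \<in> {1, 2, 3}" "\<phi>' e \<in> {1, 2, 3}"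
          using \<phi> e color_range by (auto simp: colorings_with_def)
        have "recolor \<phi> e = recolor \<phi>' e" using eq by simp
        then show ?thesis using \<open>H \<phi> = H \<phi>'\<close> e p_inj[OF _ range] q_inj[OF _ range]
          by (auto simp: recolor_def split: if_splits)
      qed
      then show "\<phi> = \<phi>'"
        using \<phi> by (intro PiE_ext[of \<phi> "arcs G" "\<lambda>_. {1, 2, 3}" \<phi>'])
          (auto simp: colorings_with_def three_edge_colorings_def)
    qed
  next
    show "recolor ` colorings_with i j \<psi> S \<subseteq> colorings_with i' j' \<psi>' S"
    proof (rule image_subsetI)
      fix \<phi> assume "\<phi> \<in> colorings_with i j \<psi> S"
      then have \<phi>: "\<phi> \<in> three_edge_colorings G v" "extends_precoloring G v \<nu> \<phi> \<psi>"
          "kempe_signature G v \<nu> i j \<phi> = S"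
        by (auto simp: colorings_with_def)
      have HI: "h \<in> H \<phi> \<longleftrightarrow> h \<in> arcs G \<times> UNIV \<and> \<phi> (fst h) \<in> {i, j}" for h
        by (simp add: H_def kempe_half_edges_def)
      have pair: "\<psi> (\<nu> h) = \<psi> (\<nu> h') \<longleftrightarrow> \<psi>' (\<nu> h) = \<psi>' (\<nu> h')"
          "(if \<phi> (fst h) = \<phi> (fst h') then -1 else 1 :: int) = -1 \<longleftrightarrow> \<psi>' (\<nu> h) = \<psi>' (\<nu> h')"
        if "(h, h') \<in> kempe_pairs G v (H \<phi>)" for h h'
      proof -
        have mem: "({\<nu> h, \<nu> h'}, if \<phi> (fst h) = \<phi> (fst h') then -1 else 1) \<in> S"
          using that by (force simp: kempe_signature_def H_def simp flip: \<phi>(3))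
        show "\<psi> (\<nu> h) = \<psi> (\<nu> h') \<longleftrightarrow> \<psi>' (\<nu> h) = \<psi>' (\<nu> h')"
          "(if \<phi> (fst h) = \<phi> (fst h') then -1 else 1 :: int) = -1 \<longleftrightarrow> \<psi>' (\<nu> h) = \<psi>' (\<nu> h')"
          using compatible_sign[OF \<psi>(2) mem] compatible_sign[OF \<psi>'(2) mem] by simp_all
      qed
      have ext: "recolor \<phi> (fst h) = \<psi>' (\<nu> h)" if h: "h \<in> half_edges_at G v" for h
      proof -
        have arc: "fst h \<in> arcs G" using h by (auto simp: half_edges_at_def)
        have \<phi>h: "\<phi> (fst h) = \<psi> (\<nu> h)" using \<phi>(2) h by (simp add: extends_precoloring_def)
        show ?thesis
        proof (cases "\<psi> (\<nu> h) \<in> {i, j}")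
          case False
          then show ?thesis using arc \<phi>h pq ends_third[OF h False] by (simp add: recolor_def)
        next
          case ij_h: True
          then have hH: "h \<in> H \<phi>" using arc \<phi>h by (cases h) (simp add: HI)
          show ?thesis
          proof (cases "h \<in> W")
            case True
            then have "fst h \<in> flipped (H \<phi>)"
              by (auto simp: flipped_def intro!: exI[of _ "snd h"] bexI[of _ h])
            moreover have "q (\<psi> (\<nu> h)) = \<psi>' (\<nu> h)"
              using pq_swap[OF ij_h] True ends(3)[OF h] ij_h by (auto simp: W_def)
            ultimately show ?thesis using arc \<phi>h by (simp add: recolor_def)
          next
            case False
            then have p_h: "p (\<psi> (\<nu> h)) = \<psi>' (\<nu> h)" using h by (simp add: W_def)
            have "fst h \<notin> flipped (H \<phi>)"
            proof
              assume "fst h \<in> flipped (H \<phi>)"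
              then obtain b h1 where h1: "h1 \<in> W" "((fst h, b), h1) \<in> (kempe_link G v (H \<phi>))\<^sup>*"
                by (auto simp: flipped_def)
              have "(h, (fst h, b)) \<in> kempe_link G v (H \<phi>)"
                using hH by (auto simp: kempe_link_def HI)
              then have link: "(h, h1) \<in> (kempe_link G v (H \<phi>))\<^sup>*"
                using h1(2) by (rule converse_rtrancl_into_rtrancl)
              have at_v: "h1 \<in> half_edges_at G v" using h1 by (simp add: W_def)
              have "h \<noteq> h1" "h1 \<in> H \<phi>" using False h1 H_closed[OF link] hH by auto
              then have hp: "(h, h1) \<in> kempe_pairs G v (H \<phi>)"
                using h hH at_v link by (simp add: kempe_pairs_def)
              have "\<psi> (\<nu> h1) \<in> {i, j}"
                using \<open>h1 \<in> H \<phi>\<close> \<phi>(2) at_v by (auto simp: HI extends_precoloring_def)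
              moreover have "p (\<psi> (\<nu> h1)) \<noteq> \<psi>' (\<nu> h1)" using h1 by (simp add: W_def)
              ultimately show False
                using pair(1)[OF hp] p_h ij_h ends(3)[OF at_v] ends(3)[OF h] p_ij
                  p_inj[OF _ ends(1)[OF h] ends(1)[OF at_v]] by (metis empty_iff insert_iff)
            qed
            then show ?thesis using arc \<phi>h p_h by (simp add: recolor_def)
          qed
        qed
      qed
      have "inj_on (\<lambda>h. recolor \<phi> (fst h)) (half_edges_at G u)" if u: "u \<in> verts G - {v}" for u
      proof (rule inj_onI)
        fix h h' assume h: "h \<in> half_edges_at G u" "h' \<in> half_edges_at G u"
          and eq: "recolor \<phi> (fst h) = recolor \<phi> (fst h')"
        have arc: "fst h \<in> arcs G" "fst h' \<in> arcs G" using h by (auto simp: half_edges_at_def)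
        have range: "\<phi> (fst h) \<in> {1, 2, 3}" "\<phi> (fst h') \<in> {1, 2, 3}"
          using arc color_range[OF \<phi>(1)] by auto
        \<comment> \<open>Half-edges colored i or j at the same vertex other than v lie on one
          chain, so the same one of the bijections \<open>p\<close>, \<open>q\<close> is applied to
          both and distinct colors stay distinct.\<close>
        have flip_iff: "fst h \<in> flipped (H \<phi>) \<longleftrightarrow> fst h' \<in> flipped (H \<phi>)"
          if "\<phi> (fst h) \<in> {i, j}" "\<phi> (fst h') \<in> {i, j}"
        proof -
          have trans: "fst x \<in> flipped (H \<phi>)"
            if x: "x \<in> H \<phi>" and y: "y \<in> H \<phi>" and yf: "fst y \<in> flipped (H \<phi>)"
              and xy: "half_edge_end G x = u" "half_edge_end G y = u" for x y
          proof -
            obtain b w where w: "w \<in> W" "((fst y, b), w) \<in> (kempe_link G v (H \<phi>))\<^sup>*"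
              using yf by (auto simp: flipped_def)
            have "(x, y) \<in> kempe_link G v (H \<phi>)" using x y xy u by (auto simp: kempe_link_def)
            moreover have "(y, (fst y, b)) \<in> kempe_link G v (H \<phi>)"
              using y by (auto simp: kempe_link_def HI)
            ultimately have "(x, w) \<in> (kempe_link G v (H \<phi>))\<^sup>*"
              using w(2) by (meson converse_rtrancl_into_rtrancl)
            then have "((fst x, snd x), w) \<in> (kempe_link G v (H \<phi>))\<^sup>*" by simp
            then show ?thesis using w(1) unfolding flipped_def by blast
          qed
          have "h \<in> H \<phi>" "h' \<in> H \<phi>" using that arc by (cases h; cases h'; simp add: HI)+
          then show ?thesis using trans[of h h'] trans[of h' h] h by (auto simp: half_edges_at_def)
        qed
        have "\<phi> (fst h) = \<phi> (fst h')"
        proof (cases "\<phi> (fst h) \<in> {i, j} \<and> \<phi> (fst h') \<in> {i, j}")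
          case True
          then show ?thesis using eq arc flip_iff p_inj[OF _ range] q_inj[OF _ range]
            by (auto simp: recolor_def split: if_splits)
        next
          case False
          have "recolor \<phi> (fst h) \<in> {i', j'} \<longleftrightarrow> \<phi> (fst h) \<in> {i, j}"
            "recolor \<phi> (fst h') \<in> {i', j'} \<longleftrightarrow> \<phi> (fst h') \<in> {i, j}"
            using arc recolor_ij by blast+
          then show ?thesis using False eq third_unique[OF range _ _ ij] by auto
        qed
        then show "h = h'" using \<phi>(1) u h by (auto simp: three_edge_colorings_def inj_on_def)
      qed
      moreover have "recolor \<phi> \<in> arcs G \<rightarrow>\<^sub>E {1, 2, 3}"
        using p_range q_range by (auto simp: recolor_def)
      \<comment> \<open>The chains are unchanged by \<open>H_recolor\<close>. The signs are
        unchanged because the new colors at v are those of \<open>\<psi>'\<close>, whose agreements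
        are prescribed by \<open>S\<close>.\<close>
      moreover have "kempe_signature G v \<nu> i' j' (recolor \<phi>) = S"
        unfolding kempe_signature_def H_recolor \<phi>(3)[symmetric] H_def[symmetric]
      proof (rule image_cong[OF refl])
        fix x assume "x \<in> kempe_pairs G v (H \<phi>)"
        moreover obtain h h' where x: "x = (h, h')" by (cases x)
        ultimately have hp: "(h, h') \<in> kempe_pairs G v (H \<phi>)" by simp
        then have at_v: "h \<in> half_edges_at G v" "h' \<in> half_edges_at G v"
          by (auto simp: kempe_pairs_def)
        have "recolor \<phi> (fst h) = recolor \<phi> (fst h') \<longleftrightarrow> \<phi> (fst h) = \<phi> (fst h')"
          using pair(2)[OF hp] by (simp add: ext at_v split: if_splits)
        then show "(case x of (h, h') \<Rightarrow>
            ({\<nu> h, \<nu> h'}, if recolor \<phi> (fst h) = recolor \<phi> (fst h') then -1 else 1 :: int)) =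
          (case x of (h, h') \<Rightarrow> ({\<nu> h, \<nu> h'}, if \<phi> (fst h) = \<phi> (fst h') then -1 else 1))"
          by (simp add: x)
      qed
      ultimately show "recolor \<phi> \<in> colorings_with i' j' \<psi>' S"
        using ext by (auto simp: colorings_with_def three_edge_colorings_def extends_precoloring_def)
    qed
  qed (rule finite_colorings_with)
qed

end

section \<open>Kempe chains of a plane graph\<close>

text \<open>Different chains may share the point of v; without it their regions are disjoint. Each
  region stays connected, as no chain passes through v.\<close>

definition kempe_region ::
    "('a, 'b) pre_digraph \<Rightarrow> 'a \<Rightarrow> ('a \<Rightarrow> complex) \<Rightarrow> ('b \<Rightarrow> real \<Rightarrow> complex) \<Rightarrow>
     ('b \<times> bool) set \<Rightarrow> 'b \<times> bool \<Rightarrow> complex set" where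
  "kempe_region G v pos curve H h =
     (\<Union>h' \<in> {h'. (h, h') \<in> (kempe_link G v H)\<^sup>*}. path_image (curve (fst h'))) - {pos v}"

context near_cubic begin

context
  fixes pos :: "'a \<Rightarrow> complex" and curve :: "'b \<Rightarrow> real \<Rightarrow> complex"
  assumes drawing: "plane_drawing G pos curve"
begin

lemma path_curve: "e \<in> arcs G \<Longrightarrow> path (curve e)"
  using drawing by (auto simp: plane_drawing_def simple_path_def)

lemma pos_eq_iff: "u \<in> verts G \<Longrightarrow> w \<in> verts G \<Longrightarrow> pos u = pos w \<longleftrightarrow> u = w"
  using drawing by (auto simp: plane_drawing_def inj_on_def)

lemma v_in_verts: "v \<in> verts G"
  using near_cubic by (simp add: near_cubic_graph_def)

lemma curve_avoids_vertices: "e \<in> arcs G \<Longrightarrow> u \<in> verts G \<Longrightarrow> t \<in> {0<..<1} \<Longrightarrow> curve e t \<noteq> pos u"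
  using drawing by (fastforce simp: plane_drawing_def)

lemma pos_half_edge_end:
  "fst h \<in> arcs G \<Longrightarrow> pos (half_edge_end G h) = (if snd h then curve (fst h) 1 else curve (fst h) 0)"
  using drawing by (auto simp: plane_drawing_def half_edge_end_def pathstart_def pathfinish_def)

lemma pos_half_edge_end_in_curve: "fst h \<in> arcs G \<Longrightarrow> pos (half_edge_end G h) \<in> path_image (curve (fst h))"
  by (auto simp: pos_half_edge_end path_image_def)

lemma curve_cases:
  assumes "e \<in> arcs G" "x \<in> path_image (curve e)"
  obtains t where "t \<in> {0<..<1}" "x = curve e t" | b where "x = pos (half_edge_end G (e, b))"
proof -
  obtain t where t: "t \<in> {0..1}" "x = curve e t" using assms(2) by (auto simp: path_image_def)
  consider "t \<in> {0<..<1}" | "t = 0" | "t = 1" using t(1) by fastforce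
  then show ?thesis
    using that(1)[of t] that(2)[of False] that(2)[of True] t(2) assms(1)
    by cases (auto simp: pos_half_edge_end)
qed

text \<open>Only the ends of a curve can lie at v, so the remaining parameters form an interval;
  this covers loops at v as well.\<close>

lemma path_connected_curve_minus:
  assumes "e \<in> arcs G"
  shows "path_connected (path_image (curve e) - {pos v})"
proof -
  let ?T = "{t \<in> {0..1}. curve e t \<noteq> pos v}"
  have T: "{0<..<1} \<subseteq> ?T" using curve_avoids_vertices[OF assms v_in_verts] by auto
  have "is_interval ?T"
    unfolding is_interval_1
  proof (intro ballI allI impI)
    fix a b x assume ab: "a \<in> ?T" "b \<in> ?T" and x: "a \<le> x \<and> x \<le> b"
    show "x \<in> ?T"
    proof (cases "x = a \<or> x = b")
      case False
      then have "x \<in> {0<..<1}" using ab x by auto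
      then show ?thesis using T by blast
    qed (use ab in auto)
  qed
  moreover have "continuous_on ?T (curve e)"
    using path_curve[OF assms] by (auto simp: path_def intro: continuous_on_subset)
  ultimately have "path_connected (curve e ` ?T)"
    by (intro path_connected_continuous_image is_interval_path_connected)
  moreover have "curve e ` ?T = path_image (curve e) - {pos v}" by (auto simp: path_image_def)
  ultimately show ?thesis by simp
qed

text \<open>Consecutive edges of a chain meet at a vertex other than v, whose point survives in the
  region and lets the path pass from one curve to the next.\<close>

lemma path_component_kempe_region:
  assumes H: "H \<subseteq> arcs G \<times> UNIV" and h: "h \<in> H"
    and hh': "(h, h') \<in> (kempe_link G v H)\<^sup>*"
    and x: "x \<in> path_image (curve (fst h)) - {pos v}" and y: "y \<in> path_image (curve (fst h')) - {pos v}"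
  shows "path_component (kempe_region G v pos curve H h) x y"
  using hh' y
proof (induction arbitrary: y)
  case base
  have "path_connected (path_image (curve (fst h)) - {pos v})"
    using h H by (intro path_connected_curve_minus) auto
  then have "path_component (path_image (curve (fst h)) - {pos v}) x y"
    using x base by (simp add: path_connected_component)
  then show ?case by (rule path_component_of_subset[rotated]) (auto simp: kempe_region_def)
next
  case (step h1 h2)
  then have H12: "h1 \<in> H" "h2 \<in> H" "fst h1 \<in> arcs G" "fst h2 \<in> arcs G"
    using H by (auto simp: kempe_link_def)
  show ?case
  proof (cases "fst h1 = fst h2")
    case True
    then show ?thesis using step by simp
  next
    case False
    define u where "u = half_edge_end G h1"
    have u: "half_edge_end G h2 = u" "u \<noteq> v" using False step(2) by (auto simp: kempe_link_def u_def)
    have "u \<in> verts G" using H12 H by (auto simp: u_def intro: half_edge_end_in_verts)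
    then have "pos u \<noteq> pos v" using u v_in_verts by (simp add: pos_eq_iff)
    then have pu: "pos u \<in> path_image (curve (fst h1)) - {pos v}"
        "pos u \<in> path_image (curve (fst h2)) - {pos v}"
      using pos_half_edge_end_in_curve[OF H12(3)] pos_half_edge_end_in_curve[OF H12(4)] u
      by (auto simp: u_def)
    then have "path_component (path_image (curve (fst h2)) - {pos v}) (pos u) y"
      using path_connected_curve_minus[OF H12(4)] step(4) by (simp add: path_connected_component)
    moreover have "(h, h2) \<in> (kempe_link G v H)\<^sup>*" using step by (meson rtrancl.rtrancl_into_rtrancl)
    then have "path_image (curve (fst h2)) - {pos v} \<subseteq> kempe_region G v pos curve H h"
      by (auto simp: kempe_region_def)
    ultimately have "path_component (kempe_region G v pos curve H h) (pos u) y"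
      by (metis path_component_of_subset)
    then show ?thesis using step.IH[OF pu(1)] path_component_trans by blast
  qed
qed

text \<open>Two different curves of the drawing can share only the point of a common vertex. If it
  is not v, the edges are linked there; closure of \<open>H\<close> under changing halves makes the
  half-edges at that vertex available.\<close>

lemma kempe_regions_disjoint:
  assumes H: "H \<subseteq> arcs G \<times> UNIV" "\<And>e b b'. (e, b) \<in> H \<Longrightarrow> (e, b') \<in> H" and h: "h1 \<in> H" "h2 \<in> H"
    and not_linked: "(h1, h2) \<notin> (kempe_link G v H)\<^sup>*"
  shows "kempe_region G v pos curve H h1 \<inter> kempe_region G v pos curve H h2 = {}"
proof (rule ccontr)
  let ?L = "(kempe_link G v H)\<^sup>*"
  assume "kempe_region G v pos curve H h1 \<inter> kempe_region G v pos curve H h2 \<noteq> {}"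
  then obtain x k1 k2 where x: "x \<noteq> pos v" and k: "(h1, k1) \<in> ?L" "(h2, k2) \<in> ?L"
      and xk: "x \<in> path_image (curve (fst k1))" "x \<in> path_image (curve (fst k2))"
    by (auto simp: kempe_region_def)
  have in_H: "k \<in> H" if "(h, k) \<in> ?L" "h \<in> H" for h k
    using that by cases (auto simp: kempe_link_def)
  have kH: "k1 \<in> H" "k2 \<in> H" using in_H k h by auto
  then have arcs: "fst k1 \<in> arcs G" "fst k2 \<in> arcs G" using H by auto
  have same_edge: "(k, (fst k, b)) \<in> kempe_link G v H" if "k \<in> H" for k b
    using that H(2)[of "fst k" "snd k" b] by (auto simp: kempe_link_def)
  have "(k1, k2) \<in> ?L"
  proof (cases "fst k1 = fst k2")
    case True
    then have "(k1, k2) \<in> kempe_link G v H" using kH by (auto simp: kempe_link_def)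
    then show ?thesis by blast
  next
    case False
    have disj: "curve (fst k1) ` {0<..<1} \<inter> curve (fst k2) ` {0<..<1} = {}"
      using drawing arcs False by (auto simp: plane_drawing_def)
    have vertex: "half_edge_end G (fst k, b) \<in> verts G" if "fst k \<in> arcs G" for k b
      using that by (intro half_edge_end_in_verts) auto
    have end_of: "\<exists>b. x = pos (half_edge_end G (fst k, b))"
      if k: "fst k \<in> arcs G" "x \<in> path_image (curve (fst k))"
        and k': "fst k' \<in> arcs G" "x \<in> path_image (curve (fst k'))"
        and disj: "curve (fst k) ` {0<..<1} \<inter> curve (fst k') ` {0<..<1} = {}" for k k'
      using k
    proof (cases rule: curve_cases)
      case (1 t)
      from k' show ?thesis
      proof (cases rule: curve_cases)
        case 1
        then show ?thesis using \<open>t \<in> _\<close> \<open>x = curve (fst k) t\<close> disj by blast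
      next
        case (2 b)
        then show ?thesis
          using curve_avoids_vertices[OF k(1) vertex[OF k'(1)] \<open>t \<in> _\<close>] \<open>x = curve (fst k) t\<close> by metis
      qed
    qed blast
    obtain b1 where b1: "x = pos (half_edge_end G (fst k1, b1))"
      using end_of[OF arcs(1) xk(1) arcs(2) xk(2) disj] by blast
    obtain b2 where b2: "x = pos (half_edge_end G (fst k2, b2))"
      using end_of[OF arcs(2) xk(2) arcs(1) xk(1)] disj by (metis Int_commute)
    have "half_edge_end G (fst k1, b1) = half_edge_end G (fst k2, b2)"
      using vertex arcs pos_eq_iff b1 b2 by metis
    moreover have "half_edge_end G (fst k1, b1) \<noteq> v" using b1 x by auto
    moreover have "(fst k1, b1) \<in> H" "(fst k2, b2) \<in> H"
      using same_edge kH by (auto simp: kempe_link_def)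
    ultimately have "((fst k1, b1), (fst k2, b2)) \<in> kempe_link G v H"
      by (auto simp: kempe_link_def)
    moreover have "((fst k2, b2), k2) \<in> kempe_link G v H"
      using same_edge[OF kH(2)] by (auto simp: kempe_link_def)
    ultimately show ?thesis using same_edge[OF kH(1), of b1]
      by (meson r_into_rtrancl rtrancl.rtrancl_into_rtrancl)
  qed
  then have "(h1, h2) \<in> ?L" using k sym_kempe_link_rtrancl[of G v H] by (meson rtrancl_trans symE)
  then show False using not_linked by simp
qed

text \<open>The ray is the piece of the half-edge up to its first hit. It does not return to v
  before, since the interior of a curve avoids all vertices.\<close>

lemma half_edge_disc_ray:
  assumes h: "h \<in> half_edges_at G v" and r: "r > 0"
    and hit: "first_hit (half_edge_curve curve h) r (pos v + of_real r * cis \<theta>)"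
  obtains i where "disc_ray (pos v) r \<theta> i" "path_image i \<subseteq> path_image (curve (fst h))"
proof -
  define g where "g = half_edge_curve curve h"
  have arc: "fst h \<in> arcs G" and v: "half_edge_end G h = v" using h by (auto simp: half_edges_at_def)
  have g: "path g" "path_image g = path_image (curve (fst h))"
    using path_curve[OF arc] by (auto simp: g_def half_edge_curve_def)
  have g0: "g 0 = pos v"
    using pos_half_edge_end[OF arc] v by (auto simp: g_def half_edge_curve_def reversepath_def)
  have g_v: "g t \<noteq> pos v" if "t \<in> {0<..<1}" for t
    using that curve_avoids_vertices[OF arc v_in_verts, of t]
      curve_avoids_vertices[OF arc v_in_verts, of "1 - t"]
    by (auto simp: g_def half_edge_curve_def reversepath_def)
  obtain t where t: "t \<in> {0..1}" "g t = pos v + of_real r * cis \<theta>"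
      "\<And>s. s \<in> {0..<t} \<Longrightarrow> dist (pos v) (g s) < r"
    using hit g0 by (auto simp: first_hit_def g_def pathstart_def)
  have "t \<noteq> 0" using t(2) g0 r by auto
  show ?thesis
  proof (rule that[of "subpath 0 t g"])
    show "path_image (subpath 0 t g) \<subseteq> path_image (curve (fst h))"
      using t(1) path_image_subpath_subset[of 0 t g] g by auto
    have "g (t * s) \<noteq> pos v \<and> dist (pos v) (g (t * s)) < r" if "s \<in> {0<..<1}" for s
    proof -
      have "0 < t * s" "t * s < t" using that t(1) \<open>t \<noteq> 0\<close> by auto
      then show ?thesis using t g_v by auto
    qed
    then show "disc_ray (pos v) r \<theta> (subpath 0 t g)"
      using t(1,2) g(1) g0 path_subpath[OF g(1), of 0 t]
      by (simp add: disc_ray_def) (simp add: subpath_def)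
  qed
qed

end

text \<open>The regions of the two chains serve as the disjoint sets \<open>X\<close> and
  \<open>Y\<close> around the centre. In a clockwise drawing the angles decrease along
  \<open>\<nu>\<close> within one turn, so alternating labels become alternating rays.\<close>

lemma kempe_pairs_not_crossing:
  assumes drawing: "plane_drawing G pos curve" and clockwise: "drawn_clockwise G v \<nu> pos curve"
    and H: "H \<subseteq> arcs G \<times> UNIV" "\<And>e b b'. (e, b) \<in> H \<Longrightarrow> (e, b') \<in> H"
    and pairs: "(ha, hb) \<in> kempe_pairs G v H" "(hc, he) \<in> kempe_pairs G v H"
    and not_linked: "(ha, hc) \<notin> (kempe_link G v H)\<^sup>*"
    and order: "\<nu> ha < \<nu> hc" "\<nu> hc < \<nu> hb" "\<nu> hb < \<nu> he"
  shows False
proof -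
  obtain r \<theta> where r: "r > 0"
    and hit: "\<And>h. h \<in> half_edges_at G v \<Longrightarrow>
      first_hit (half_edge_curve curve h) r (pos v + of_real r * cis (\<theta> (\<nu> h)))"
    and decr: "\<And>k j. k < vertex_degree G v \<Longrightarrow> j < k \<Longrightarrow> \<theta> k < \<theta> j"
    and turn: "\<And>k. k < vertex_degree G v \<Longrightarrow> \<theta> 0 - 2 * pi < \<theta> k"
    using clockwise unfolding drawn_clockwise_def by blast
  have at_v: "h \<in> half_edges_at G v" and in_H: "h \<in> H" if "h \<in> {ha, hb, hc, he}" for h
    using that pairs by (auto simp: kempe_pairs_def)
  note less = \<nu>_less[OF at_v]
  let ?X = "kempe_region G v pos curve H"
  have link: "(ha, hb) \<in> (kempe_link G v H)\<^sup>*" "(hc, he) \<in> (kempe_link G v H)\<^sup>*"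
    using pairs by (auto simp: kempe_pairs_def)
  have ray: "\<exists>i. disc_ray (pos v) r (\<theta> (\<nu> h)) i \<and> path_image i \<subseteq> path_image (curve (fst h))"
    if "h \<in> {ha, hb, hc, he}" for h
    using half_edge_disc_ray[OF drawing at_v[OF that] r hit[OF at_v[OF that]]] by metis
  obtain ia ib ic ie where rays: "disc_ray (pos v) r (\<theta> (\<nu> ha)) ia" "disc_ray (pos v) r (\<theta> (\<nu> hb)) ib"
      "disc_ray (pos v) r (\<theta> (\<nu> hc)) ic" "disc_ray (pos v) r (\<theta> (\<nu> he)) ie"
    and images: "path_image ia \<subseteq> path_image (curve (fst ha))" "path_image ib \<subseteq> path_image (curve (fst hb))"
      "path_image ic \<subseteq> path_image (curve (fst hc))" "path_image ie \<subseteq> path_image (curve (fst he))"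
    using ray[of ha] ray[of hb] ray[of hc] ray[of he] by auto
  have sub: "path_image i \<subseteq> insert (pos v) (?X h)"
    if "path_image i \<subseteq> path_image (curve (fst h'))" "(h, h') \<in> (kempe_link G v H)\<^sup>*" for i h h'
    using that by (auto simp: kempe_region_def)
  have fin: "pathfinish i \<in> path_image (curve (fst h)) - {pos v}"
    if "disc_ray (pos v) r \<theta>' i" "path_image i \<subseteq> path_image (curve (fst h))" for i \<theta>' h
    using that r pathfinish_in_path_image[of i] by (auto simp: disc_ray_def)
  show False
  proof (rule disc_rays_not_crossing[OF r rays])
    show "path_image ia \<subseteq> insert (pos v) (?X ha)" "path_image ib \<subseteq> insert (pos v) (?X ha)"
      "path_image ic \<subseteq> insert (pos v) (?X hc)" "path_image ie \<subseteq> insert (pos v) (?X hc)"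
      using sub images link by blast+
    show "path_component (?X ha) (pathfinish ia) (pathfinish ib)"
      by (rule path_component_kempe_region[OF drawing H(1) in_H link(1)]) (use fin rays images in auto)
    show "path_component (?X hc) (pathfinish ic) (pathfinish ie)"
      by (rule path_component_kempe_region[OF drawing H(1) in_H link(2)]) (use fin rays images in auto)
    show "?X ha \<inter> ?X hc = {}"
      by (rule kempe_regions_disjoint[OF drawing H in_H in_H not_linked]) auto
    show "pos v \<notin> ?X ha" "pos v \<notin> ?X hc" by (auto simp: kempe_region_def)
    show "\<theta> (\<nu> hc) < \<theta> (\<nu> ha)" "\<theta> (\<nu> hb) < \<theta> (\<nu> hc)" "\<theta> (\<nu> he) < \<theta> (\<nu> hb)"
      using order less decr by auto
    \<comment> \<open>The single-turn bound is stated relative to \<open>\<theta> 0\<close>, and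
      \<open>ha\<close> need not be the half-edge numbered 0.\<close>
    have "\<theta> (\<nu> ha) \<le> \<theta> 0" using decr[of "\<nu> ha" 0] less[of ha] by (cases "\<nu> ha = 0") auto
    then show "\<theta> (\<nu> ha) - 2 * pi < \<theta> (\<nu> he)" using turn[of "\<nu> he"] less[of he] by simp
  qed
qed

lemma kempe_signature_in_signatures:
  assumes drawing: "plane_drawing G pos curve" and clockwise: "drawn_clockwise G v \<nu> pos curve"
    and \<phi>: "\<phi> \<in> three_edge_colorings G v"
    and ij: "i \<in> {1, 2, 3}" "j \<in> {1, 2, 3}" "i \<noteq> j"
  shows "kempe_signature G v \<nu> i j \<phi> \<in> signatures (vertex_degree G v)"
proof -
  define H where "H = kempe_half_edges G \<phi> i j"
  define P where "P = kempe_pairs G v H"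
  have S: "\<exists>h h'. (h, h') \<in> P \<and> m = {\<nu> h, \<nu> h'} \<and> s = (if \<phi> (fst h) = \<phi> (fst h') then -1 else 1)"
    if "(m, s) \<in> kempe_signature G v \<nu> i j \<phi>" for m s
    using that by (force simp: kempe_signature_def P_def H_def)
  have P: "h \<in> half_edges_at G v" "h' \<in> half_edges_at G v" "h \<noteq> h'" "(h', h) \<in> P"
    if "(h, h') \<in> P" for h h'
    using that sym_kempe_pairs[of G v H] by (auto simp: P_def kempe_pairs_def dest: symD)
  have P_unique: "h1 = h2" if "(h, h1) \<in> P" "(h, h2) \<in> P" for h h1 h2
    using kempe_pairs_unique[OF \<phi> ij] that by (simp add: P_def H_def)
  have pairs: "kempe_signature G v \<nu> i j \<phi> \<subseteq> {m. m \<subseteq> {0..<vertex_degree G v} \<and> card m = 2} \<times> {-1, 1}"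
  proof (rule subrelI)
    fix m s assume "(m, s) \<in> kempe_signature G v \<nu> i j \<phi>"
    then obtain h h' where "(h, h') \<in> P" "m = {\<nu> h, \<nu> h'}" "s \<in> {-1, 1}" using S by fastforce
    then show "(m, s) \<in> {m. m \<subseteq> {0..<vertex_degree G v} \<and> card m = 2} \<times> {-1, 1}"
      using P[of h h'] \<nu>_less \<nu>_inj by auto
  qed
  have disjoint: "fst p \<inter> fst q = {}"
    if p: "p \<in> kempe_signature G v \<nu> i j \<phi>" and q: "q \<in> kempe_signature G v \<nu> i j \<phi>" and "p \<noteq> q" for p q
  proof (rule ccontr)
    assume meet: "fst p \<inter> fst q \<noteq> {}"
    obtain h h' where h: "(h, h') \<in> P" "fst p = {\<nu> h, \<nu> h'}"
        "snd p = (if \<phi> (fst h) = \<phi> (fst h') then -1 else 1)"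
      using S[of "fst p" "snd p"] p by auto
    obtain k k' where k: "(k, k') \<in> P" "fst q = {\<nu> k, \<nu> k'}"
        "snd q = (if \<phi> (fst k) = \<phi> (fst k') then -1 else 1)"
      using S[of "fst q" "snd q"] q by auto
    \<comment> \<open>Partners are unique and \<open>P\<close> is symmetric, so two pairs sharing an
      end coincide up to order; then the signs agree too.\<close>
    have "{h, h'} \<inter> {k, k'} \<noteq> {}" using meet h k P \<nu>_inj by auto
    then have "(h = k \<and> h' = k') \<or> (h = k' \<and> h' = k)"
      using h(1) k(1) P(4) P_unique by blast
    then have "fst p = fst q" "snd p = snd q" using h k by auto
    then have "p = q" by (rule prod_eqI)
    then show False using \<open>p \<noteq> q\<close> by simp
  qed
  have not_crossing: False
    if ab: "({a, b}, s1) \<in> kempe_signature G v \<nu> i j \<phi>" and ce: "({c, e}, s2) \<in> kempe_signature G v \<nu> i j \<phi>"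
      and order: "a < c" "c < b" "b < e" for a b c e s1 s2
  proof -
    have ordered: "\<exists>h h'. (h, h') \<in> P \<and> \<nu> h = x \<and> \<nu> h' = y"
      if xy: "({x, y}, s) \<in> kempe_signature G v \<nu> i j \<phi>" for x y s
    proof -
      obtain h h' where h: "(h, h') \<in> P" "{x, y} = {\<nu> h, \<nu> h'}" using S[OF xy] by blast
      then have "\<nu> h = x \<and> \<nu> h' = y \<or> \<nu> h' = x \<and> \<nu> h = y" by (auto simp: doubleton_eq_iff)
      then show ?thesis using h(1) P(4)[OF h(1)] by blast
    qed
    obtain ha hb where hab: "(ha, hb) \<in> P" "\<nu> ha = a" "\<nu> hb = b" using ordered[OF ab] by blast
    obtain hc he where hce: "(hc, he) \<in> P" "\<nu> hc = c" "\<nu> he = e" using ordered[OF ce] by blast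
    \<comment> \<open>Otherwise \<open>hc\<close> would be the partner of \<open>ha\<close>, hence
      equal to \<open>hb\<close>, although its number c is less than b.\<close>
    have "(ha, hc) \<notin> (kempe_link G v H)\<^sup>*"
    proof
      assume "(ha, hc) \<in> (kempe_link G v H)\<^sup>*"
      then have "(ha, hc) \<in> P"
        using hab hce order by (auto simp: P_def kempe_pairs_def)
      then show False using P_unique[OF hab(1)] hab hce order by auto
    qed
    then show False
      using kempe_pairs_not_crossing[OF drawing clockwise, of H ha hb hc he] hab hce order
      by (auto simp: P_def H_def kempe_half_edges_def)
  qed
  show ?thesis
    unfolding signatures_def
  proof (intro CollectI conjI ballI impI)
    show "\<not> (\<exists>a b c e s1 s2. ({a, b}, s1) \<in> kempe_signature G v \<nu> i j \<phi> \<and>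
        ({c, e}, s2) \<in> kempe_signature G v \<nu> i j \<phi> \<and> a < c \<and> c < b \<and> b < e)"
      by (intro notI, elim exE conjE, rule not_crossing)
  qed (rule pairs disjoint; assumption)+
qed

end

section \<open>The coloring count vector\<close>

text \<open>Compatibility sees only which positions carry the two colors and where these agree, so
  it survives renaming. This brings every color pair to 1, 2, where \<open>y\<close> will be
  defined.\<close>

lemma compatible_recolor:
  assumes "compatible d \<psi> i j S" "i \<noteq> j" "i' \<noteq> j'" "c \<notin> {i', j'}"
  shows "compatible d (\<lambda>k. if \<psi> k = i then i' else if \<psi> k = j then j' else c) i' j' S"
    (is "compatible d ?\<psi> i' j' S")
proof -
  have "?\<psi> k \<in> {i', j'} \<longleftrightarrow> \<psi> k \<in> {i, j}" for k using assms(3,4) by auto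
  then have "{k \<in> {0..<d}. ?\<psi> k \<in> {i', j'}} = {k \<in> {0..<d}. \<psi> k \<in> {i, j}}" by simp
  also have U: "\<dots> = (\<Union>p \<in> S. fst p)" using assms(1) by (simp add: compatible_def)
  finally have "{k \<in> {0..<d}. ?\<psi> k \<in> {i', j'}} = (\<Union>p \<in> S. fst p)" .
  moreover have "?\<psi> a = ?\<psi> b \<longleftrightarrow> s = -1" if "({a, b}, s) \<in> S" for a b s
  proof -
    have "{a, b} \<subseteq> (\<Union>p \<in> S. fst p)" using that by fastforce
    then have "\<psi> a \<in> {i, j}" "\<psi> b \<in> {i, j}" unfolding U[symmetric] by auto
    then have "?\<psi> a = ?\<psi> b \<longleftrightarrow> \<psi> a = \<psi> b" using assms(2,3) by auto
    then show ?thesis using compatible_sign[OF assms(1) that] by simp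
  qed
  ultimately show ?thesis unfolding compatible_def by blast
qed

context near_cubic begin

text \<open>Planarity is isolated in the assumption \<open>signature\<close>. What remains is
  counting: for fixed \<open>\<psi>\<close>, i, j the colorings extending \<open>\<psi>\<close> are
  partitioned by their signature, only compatible signatures occur, and the class of
  \<open>S\<close> has \<open>y S\<close> elements.\<close>

lemma coloring_count_vector_in_cone:
  assumes signature: "\<And>\<phi> i j. \<lbrakk>\<phi> \<in> three_edge_colorings G v; i \<in> {1, 2, 3}; j \<in> {1, 2, 3}; i \<noteq> j\<rbrakk> \<Longrightarrow>
    kempe_signature G v \<nu> i j \<phi> \<in> signatures (vertex_degree G v)"
  shows "coloring_count_vector G v \<nu> \<in> coloring_count_cone (vertex_degree G v)"
proof -
  define d where "d = vertex_degree G v"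
  define good where "good S \<psi> \<longleftrightarrow> \<psi> \<in> {0..<d} \<rightarrow> {1, 2, 3} \<and> compatible d \<psi> 1 2 S" for S \<psi>
  \<comment> \<open>The choice of \<open>\<psi>\<close> is immaterial by
    \<open>card_colorings_with_le\<close> in both directions. If no choice exists, \<open>S\<close>
    is compatible with no precoloring in any two colors, so its value enters no sum and only has to
    be nonnegative.\<close>
  define y where "y = (\<lambda>S \<in> signatures d. real (card (colorings_with 1 2 (SOME \<psi>. good S \<psi>) S)))"
  have y: "y S = real (card (colorings_with i j \<psi> S))"
    if S: "S \<in> compatible_signatures d \<psi> i j" and \<psi>: "\<psi> \<in> {0..<d} \<rightarrow> {1, 2, 3}"
      and ij: "i \<in> {1, 2, 3}" "j \<in> {1, 2, 3}" "i \<noteq> j" for S \<psi> i j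
  proof -
    have c: "compatible d \<psi> i j S" "S \<in> signatures d"
      using S by (auto simp: compatible_signatures_def)
    have "good S (\<lambda>k. if \<psi> k = i then 1 else if \<psi> k = j then 2 else 3)"
      using compatible_recolor[OF c(1) ij(3), of 1 2 3] by (simp add: good_def)
    then have "good S (SOME \<psi>. good S \<psi>)" by (rule someI[of "good S"])
    then have "card (colorings_with 1 2 (SOME \<psi>. good S \<psi>) S) = card (colorings_with i j \<psi> S)"
      using c(1) \<psi> ij unfolding good_def d_def
      by (intro antisym card_colorings_with_le) auto
    then show ?thesis using c(2) by (simp add: y_def)
  qed
  have count: "coloring_count_vector G v \<nu> \<psi> = (\<Sum>S \<in> compatible_signatures d \<psi> i j. y S)"
    if \<psi>: "\<psi> \<in> precolorings d" and ij: "i \<in> {1, 2, 3}" "j \<in> {1, 2, 3}" "i \<noteq> j" for \<psi> i j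
  proof -
    define E where "E = {\<phi> \<in> three_edge_colorings G v. extends_precoloring G v \<nu> \<phi> \<psi>}"
    have fin: "finite E" using finite_three_edge_colorings by (simp add: E_def)
    have \<psi>': "\<psi> \<in> {0..<d} \<rightarrow> {1, 2, 3}" using \<psi> by (auto simp: precolorings_def)
    have "kempe_signature G v \<nu> i j ` E \<subseteq> compatible_signatures d \<psi> i j"
      using signature[OF _ ij] compatible_kempe_signature[OF _ _ ij]
      by (auto simp: E_def compatible_signatures_def d_def)
    moreover have "finite (compatible_signatures d \<psi> i j)"
      using finite_signatures[of d] by (simp add: compatible_signatures_def)
    ultimately have "(\<Sum>S \<in> compatible_signatures d \<psi> i j.
        \<Sum>\<phi> | \<phi> \<in> E \<and> kempe_signature G v \<nu> i j \<phi> = S. 1) = (\<Sum>\<phi> \<in> E. 1 :: nat)"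
      using fin by (intro sum.group)
    moreover have "{\<phi>. \<phi> \<in> E \<and> kempe_signature G v \<nu> i j \<phi> = S} = colorings_with i j \<psi> S" for S
      by (auto simp: E_def colorings_with_def)
    ultimately have "card E = (\<Sum>S \<in> compatible_signatures d \<psi> i j. card (colorings_with i j \<psi> S))"
      by simp
    then show ?thesis
      using \<psi> y[OF _ \<psi>' ij] by (simp add: coloring_count_vector_def E_def d_def)
  qed
  have "coloring_count_vector G v \<nu> \<in> precolorings d \<rightarrow>\<^sub>E UNIV"
    and "\<forall>\<psi> \<in> precolorings d. 0 \<le> coloring_count_vector G v \<nu> \<psi>"
    by (auto simp: coloring_count_vector_def d_def)
  moreover have "y \<in> signatures d \<rightarrow>\<^sub>E UNIV" "\<forall>S \<in> signatures d. 0 \<le> y S"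
    by (auto simp: y_def)
  ultimately show ?thesis
    unfolding coloring_count_cone_def d_def[symmetric] using count by blast
qed

end

theorem theorem5:
  fixes G :: "('a, 'b) pre_digraph" and v :: 'a and \<nu> :: "'b \<times> bool \<Rightarrow> nat"
    and pos :: "'a \<Rightarrow> complex" and curve :: "'b \<Rightarrow> real \<Rightarrow> complex"
  assumes "plane_near_cubic_graph G v \<nu> pos curve"
    and "vertex_degree G v \<ge> 2"
  shows "coloring_count_vector G v \<nu> \<in> coloring_count_cone (vertex_degree G v)"
proof -
  interpret near_cubic G v \<nu>
    using assms(1) by unfold_locales (simp add: plane_near_cubic_graph_def)
  show ?thesis
    using assms(1) by (intro coloring_count_vector_in_cone kempe_signature_in_signatures)
      (auto simp: plane_near_cubic_graph_def)
qed

end
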